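(* Let $\Lambda>0$, let $z\in\mathbb{C}$ with $\operatorname{Im} z>0$, and let $H_0\equiv\frac12 I$ on $[0,\Lambda]$. There exist constants $r(z,\Lambda)>0$ and $C(z,\Lambda)>0$ such that the following holds. Let $q\in L^1(0,\Lambda)\cap L^\infty(0,\Lambda)$ be complex-valued and put $\Delta H(s)=X_{q(s)}$. If $$\|\Delta H\|_{L^\infty(0,\Lambda;\mathrm{op})}\le \tfrac14\qquad\text{and}\qquad \|\Delta H\|_{L^1(0,\Lambda;\mathrm{op})}\le r(z,\Lambda),$$ then $$v_{H_0+\Delta H,\Lambda}(z)=-iz\int_0^\Lambda q(s)e^{izs}\,ds+R_z(\Delta H),\qquad |R_z(\Delta H)|\le C(z,\Lambda)\,\|\Delta H\|_{L^1(0,\Lambda;\mathrm{op})}^2 .$$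
   Context: Let $J=\begin{pmatrix}0&-1\\1&0\end{pmatrix}$. A trace-normed Hamiltonian on $[0,\Lambda]$ is a measurable $H:[0,\Lambda]\to\mathbb{R}^{2\times2}$ with $H(s)$ symmetric, $H(s)\succeq0$ and $\operatorname{tr}H(s)=1$ for a.e. $s$; it is extended to $[0,\infty)$ by the free tail $H(s)=\frac12I$ for $s\ge\Lambda$. For $\operatorname{Im}z>0$, the Weyl coefficient $m_{H,\Lambda}(z)$ is the unique $m\in\mathbb{C}$ such that the solution of $JY'(s)=zH(s)Y(s)$ on $[0,\infty)$ with $Y(0)=(1,m)^\top$ is square-integrable, i.e. $\int_0^\infty Y^*HY\,ds<\infty$; it satisfies $\operatorname{Im}m_{H,\Lambda}(z)>0$. Its Schur transform is $v_{H,\Lambda}(z)=\dfrac{m_{H,\Lambda}(z)-i}{m_{H,\Lambda}(z)+i}$. For $q\in\mathbb{C}$, $X_q:=\begin{pmatrix}\operatorname{Re}q&\operatorname{Im}q\\ \operatorname{Im}q&-\operatorname{Re}q\end{pmatrix}$. $\|\cdot\|_{\mathrm{op}}$ is the Euclidean operator norm on matrices and $\|F\|_{L^p(0,\Lambda;\mathrm{op})}$ is the $L^p(0,\Lambda)$ norm of $s\mapsto\|F(s)\|_{\mathrm{op}}$. The bound $\|\Delta H\|_{L^\infty(0,\Lambda;\mathrm{op})}\le\frac14$ guarantees that $H_0+\Delta H$ is a trace-normed Hamiltonian. *)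

theory Defs
  imports "HOL-Analysis.Analysis" "HOL-Probability.Essential_Supremum"
begin

definition Jmat :: "complex^2^2" where
  "Jmat = vector [vector [0, -1], vector [1, 0]]"

definition Xmat :: "complex \<Rightarrow> real^2^2" where
  "Xmat q = vector [vector [Re q, Im q], vector [Im q, - Re q]]"

definition half_id :: "real^2^2" where
  "half_id = (1/2) *\<^sub>R mat 1"

text \<open>The Euclidean operator norm and the norms of \<open>L\<^sup>1(0,\<Lambda>;op)\<close> and \<open>L\<^sup>\<infinity>(0,\<Lambda>;op)\<close>.
  Functions on \<open>[0,\<Lambda>]\<close> are represented by total functions on the reals
  whose values outside \<open>[0,\<Lambda>]\<close> are irrelevant.\<close>

definition op_norm :: "real^2^2 \<Rightarrow> real" where
  "op_norm A = onorm (\<lambda>x. A *v x)"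

definition L1_op :: "real \<Rightarrow> (real \<Rightarrow> real^2^2) \<Rightarrow> real" where
  "L1_op \<Lambda> F = (LINT s|lebesgue_on {0..\<Lambda>}. op_norm (F s))"

definition Linf_op :: "real \<Rightarrow> (real \<Rightarrow> real^2^2) \<Rightarrow> ereal" where
  "Linf_op \<Lambda> F = esssup (lebesgue_on {0..\<Lambda>}) (\<lambda>s. ereal (op_norm (F s)))"

definition in_L1_Linf :: "real \<Rightarrow> (real \<Rightarrow> complex) \<Rightarrow> bool" where
  "in_L1_Linf \<Lambda> q \<longleftrightarrow> integrable (lebesgue_on {0..\<Lambda>}) q \<and>
     esssup (lebesgue_on {0..\<Lambda>}) (\<lambda>s. ereal (norm (q s))) < \<infinity>"

definition trace_normed_hamiltonian :: "real \<Rightarrow> (real \<Rightarrow> real^2^2) \<Rightarrow> bool" where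
  "trace_normed_hamiltonian \<Lambda> H \<longleftrightarrow>
     H \<in> borel_measurable (lebesgue_on {0..\<Lambda>}) \<and>
     (AE s in lebesgue_on {0..\<Lambda>}.
        transpose (H s) = H s \<and> (\<forall>x. 0 \<le> x \<bullet> (H s *v x)) \<and> trace (H s) = 1)"

definition free_tail :: "real \<Rightarrow> (real \<Rightarrow> real^2^2) \<Rightarrow> real \<Rightarrow> real^2^2" where
  "free_tail \<Lambda> H s = (if s < \<Lambda> then H s else half_id)"

definition cmat :: "real^2^2 \<Rightarrow> complex^2^2" where
  "cmat A = map_matrix of_real A"

text \<open>Since \<open>H\<close> is merely measurable, a solution of \<open>J Y' = z H Y\<close> on \<open>[0,\<infinity>)\<close> is
  understood in the Caratheodory sense: \<open>Y\<close> is locally absolutely continuous, that is, the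
  primitive of a locally integrable function \<open>Y'\<close>, and the equation holds almost everywhere.\<close>

definition canonical_solution :: "(real \<Rightarrow> real^2^2) \<Rightarrow> complex \<Rightarrow> (real \<Rightarrow> complex^2) \<Rightarrow> bool" where
  "canonical_solution H z Y \<longleftrightarrow>
     (\<exists>Y'. (\<forall>t\<ge>0. integrable (lebesgue_on {0..t}) Y' \<and>
                  Y t = Y 0 + (LINT s|lebesgue_on {0..t}. Y' s)) \<and>
           (AE s in lebesgue_on {0..}. Jmat *v Y' s = z *s (cmat (H s) *v Y s)))"

text \<open>\<open>Y\<^sup>* A Y\<close>, where \<open>A\<close> is a real matrix and \<open>Y\<close> a complex vector.\<close>

definition herm_form :: "real^2^2 \<Rightarrow> complex^2 \<Rightarrow> complex" where
  "herm_form A Y = (\<Sum>i\<in>UNIV. cnj (Y $ i) * (cmat A *v Y) $ i)"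

definition square_integrable :: "(real \<Rightarrow> real^2^2) \<Rightarrow> (real \<Rightarrow> complex^2) \<Rightarrow> bool" where
  "square_integrable H Y \<longleftrightarrow> integrable (lebesgue_on {0..}) (\<lambda>s. herm_form (H s) (Y s))"

definition weyl_coeff :: "(real \<Rightarrow> real^2^2) \<Rightarrow> real \<Rightarrow> complex \<Rightarrow> complex" where
  "weyl_coeff H \<Lambda> z = (THE m. \<exists>Y. canonical_solution (free_tail \<Lambda> H) z Y \<and>
     Y 0 = vector [1, m] \<and> square_integrable (free_tail \<Lambda> H) Y)"

definition schur_transform :: "(real \<Rightarrow> real^2^2) \<Rightarrow> real \<Rightarrow> complex \<Rightarrow> complex" where
  "schur_transform H \<Lambda> z = (weyl_coeff H \<Lambda> z - \<i>) / (weyl_coeff H \<Lambda> z + \<i>)"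

lemma Xmat_nth [simp]:
  "Xmat q $ 1 $ 1 = Re q" "Xmat q $ 1 $ 2 = Im q"
  "Xmat q $ 2 $ 1 = Im q" "Xmat q $ 2 $ 2 = - Re q"
  by (simp_all add: Xmat_def)

text \<open>The smallness condition guarantees that the perturbed matrix function is again a
  trace-normed Hamiltonian.\<close>

lemma trace_normed_hamiltonian_perturbed:
  assumes q: "in_L1_Linf \<Lambda> q" and small: "Linf_op \<Lambda> (\<lambda>s. Xmat (q s)) \<le> 1/4"
  shows "trace_normed_hamiltonian \<Lambda> (\<lambda>s. half_id + Xmat (q s))"
proof -
  let ?M = "lebesgue_on {0..\<Lambda>}"
  have qm: "q \<in> borel_measurable ?M"
    using q by (auto simp: in_L1_Linf_def)
  have lin: "linear Xmat"
    by (rule linearI) (simp_all add: vec_eq_iff forall_2)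
  have "continuous_on UNIV (\<lambda>w. half_id + Xmat w)"
    by (intro continuous_intros linear_continuous_on linear_conv_bounded_linear[THEN iffD1] lin)
  then have meas: "(\<lambda>s. half_id + Xmat (q s)) \<in> borel_measurable ?M"
    using qm by (rule borel_measurable_continuous_on)
  have ae: "AE s in ?M. ereal (op_norm (Xmat (q s))) \<le> 1/4"
    using esssup_AE[of "\<lambda>s. ereal (op_norm (Xmat (q s)))" ?M]
      small unfolding Linf_op_def by (auto elim: eventually_mono)
  have pos: "0 \<le> x \<bullet> ((half_id + Xmat w) *v x)" if w: "ereal (op_norm (Xmat w)) \<le> 1/4" for w x
  proof -
    have w': "op_norm (Xmat w) \<le> 1/4"
      using w by (simp add: one_ereal_def numeral_eq_ereal)
    have "norm (Xmat w *v x) \<le> op_norm (Xmat w) * norm x"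
      unfolding op_norm_def by (rule onorm) (rule matrix_vector_mul_bounded_linear)
    also have "\<dots> \<le> 1/4 * norm x"
      using w' by (rule mult_right_mono) simp
    finally have "\<bar>x \<bullet> (Xmat w *v x)\<bar> \<le> norm x * (1/4 * norm x)"
      by (meson Cauchy_Schwarz_ineq2 mult_left_mono norm_ge_zero order_trans)
    moreover have "half_id *v x = (1/2) *\<^sub>R x"
      by (simp add: half_id_def scaleR_matrix_vector_assoc[symmetric])
    then have "x \<bullet> ((half_id + Xmat w) *v x) = 1/2 * (norm x)^2 + x \<bullet> (Xmat w *v x)"
      by (simp add: matrix_vector_mult_add_rdistrib inner_add_right power2_norm_eq_inner)
    ultimately show ?thesis
      using zero_le_power2[of "norm x"] by (simp add: power2_eq_square)
  qed
  have "transpose (half_id + Xmat w) = half_id + Xmat w" "trace (half_id + Xmat w) = 1" for w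
    by (simp_all add: half_id_def vec_eq_iff forall_2 transpose_def trace_def sum_2 mat_def)
  with ae meas pos show ?thesis
    unfolding trace_normed_hamiltonian_def by (auto elim!: eventually_mono)
qed

end

theory Submission
  imports Defs
begin

text \<open>
  Let \<open>(1, i)\<close>, \<open>(1, -i)\<close> be the eigenvectors of \<open>J\<close> and write a solution as
  \<open>Y = e\<^bsup>izs/2\<^esup> A (1, i) + e\<^bsup>-izs/2\<^esup> B (1, -i)\<close>. The equation becomes
  \<open>A' = k\<^sub>1 B\<close>, \<open>B' = - k\<^sub>2 A\<close> with \<open>k\<^sub>1 = i z cnj q e\<^bsup>-izs\<^esup>\<close> and
  \<open>k\<^sub>2 = i z q e\<^bsup>izs\<^esup>\<close>, and \<open>v = - B(0) / A(0)\<close>. Square integrability on the free tail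
  means \<open>B = 0\<close> there. With \<open>A(0) = 1\<close> this is the Volterra system
  \<open>A(s) = 1 + \<integral>\<^sub>0\<^sup>s k\<^sub>1 B\<close>, \<open>B(s) = \<integral>\<^sub>s\<^sup>\<infinity> k\<^sub>2 A\<close>, a contraction for
  small \<open>q\<close> in \<open>L\<^sup>1\<close>. Replacing \<open>A\<close> by 1 in \<open>v = - \<integral> k\<^sub>2 A\<close> gives the linear term,
  and \<open>A - 1\<close> is already quadratic in \<open>q\<close>.
\<close>

subsection \<open>Indefinite Lebesgue integrals\<close>

text \<open>This isolates the integral clause of \<open>canonical_solution\<close>: local absolute
  continuity on the half-line with a chosen derivative. Values of \<open>f\<close> at negative
  arguments stay unconstrained.\<close>

definition primitive_of :: "(real \<Rightarrow> 'a::euclidean_space) \<Rightarrow> (real \<Rightarrow> 'a) \<Rightarrow> bool" where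
  "primitive_of f' f \<longleftrightarrow> (\<forall>t\<ge>0. integrable (lebesgue_on {0..t}) f' \<and>
     f t = f 0 + (LINT s|lebesgue_on {0..t}. f' s))"

lemma primitive_ofD:
  assumes "primitive_of f' f" "t \<ge> 0"
  shows "integrable (lebesgue_on {0..t}) f'" "f t = f 0 + (LINT s|lebesgue_on {0..t}. f' s)"
  using assms unfolding primitive_of_def by blast+

lemma integrable_mult_bounded:
  fixes f g :: "'a \<Rightarrow> complex"
  assumes f: "integrable M f" and g: "g \<in> borel_measurable M"
    and bd: "\<And>x. x \<in> space M \<Longrightarrow> norm (g x) \<le> C"
  shows "integrable M (\<lambda>x. f x * g x)"
proof (rule Bochner_Integration.integrable_bound)
  show "integrable M (\<lambda>x. of_real C * f x)" using f by simp
  show "(\<lambda>x. f x * g x) \<in> borel_measurable M" using f g by measurable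
  show "AE x in M. norm (f x * g x) \<le> norm (of_real C * f x)"
  proof (rule AE_I2)
    fix x assume x: "x \<in> space M"
    have "norm (g x) \<le> \<bar>C\<bar>" using bd[OF x] by linarith
    then show "norm (f x * g x) \<le> norm (of_real C * f x)"
      by (simp add: norm_mult mult.commute[of _ "norm (f x)"] mult_left_mono)
  qed
qed

text \<open>Integrals over varying intervals become integrals against one fixed measure, with the
  interval moved into an indicator. Fubini's theorem is applied in that form.\<close>

lemma integral_lebesgue_on_subset:
  fixes f :: "real \<Rightarrow> 'a::euclidean_space"
  assumes "S \<subseteq> T" "S \<in> sets lebesgue" "T \<in> sets lebesgue"
  shows "integral\<^sup>L (lebesgue_on S) f = (LINT x|lebesgue_on T. indicator S x *\<^sub>R f x)"
proof -
  have "indicator T x *\<^sub>R indicator S x *\<^sub>R f x = indicator S x *\<^sub>R f x" for x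
    using assms(1) by (auto simp: indicator_def)
  then show ?thesis
    using assms(2,3) by (simp add: integral_restrict_space del: scaleR_scaleR)
qed

lemma integrable_lebesgue_on_indicator:
  fixes f :: "real \<Rightarrow> 'a::euclidean_space"
  assumes "integrable (lebesgue_on T) f" "S \<in> sets lebesgue" "T \<in> sets lebesgue"
  shows "integrable (lebesgue_on T) (\<lambda>x. indicator S x *\<^sub>R f x)"
proof -
  have eq: "integrable (lebesgue_on T) h = integrable lebesgue (\<lambda>x. indicator T x *\<^sub>R h x)"
    for h :: "real \<Rightarrow> 'a"
    using assms(3) by (intro integrable_restrict_space) auto
  have "integrable lebesgue (\<lambda>x. indicator S x *\<^sub>R indicator T x *\<^sub>R f x)"
    using assms(1) unfolding eq by (rule integrable_mult_indicator[OF assms(2)])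
  then show ?thesis
    unfolding eq by (simp only: scaleR_left_commute)
qed

lemma integrable_lebesgue_on_subset:
  fixes f :: "real \<Rightarrow> 'a::euclidean_space"
  assumes f: "integrable (lebesgue_on T) f" and "S \<subseteq> T" "S \<in> sets lebesgue" "T \<in> sets lebesgue"
  shows "integrable (lebesgue_on S) f"
proof -
  have "integrable lebesgue (\<lambda>x. indicator T x *\<^sub>R f x)"
    using f by (rule integrable_restrict_space[THEN iffD1, rotated]) (use assms(4) in simp)
  then have "integrable lebesgue (\<lambda>x. indicator S x *\<^sub>R (indicator T x *\<^sub>R f x))"
    by (rule integrable_mult_indicator[OF assms(3)])
  moreover have "indicator S x *\<^sub>R (indicator T x *\<^sub>R f x) = indicator S x *\<^sub>R f x" for x
    using assms(2) by (auto simp: indicator_def)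
  ultimately have "integrable lebesgue (\<lambda>x. indicator S x *\<^sub>R f x)" by (simp only:)
  then show ?thesis
    by (rule integrable_restrict_space[THEN iffD2, rotated]) (use assms(3) in simp)
qed

lemma integrable_lebesgue_onI:
  fixes h :: "real \<Rightarrow> 'a::euclidean_space"
  assumes "integrable lebesgue h" "S \<in> sets lebesgue"
  shows "integrable (lebesgue_on S) h"
  by (rule integrable_restrict_space[THEN iffD2, rotated])
    (use integrable_mult_indicator[OF assms(2,1)] assms(2) in simp_all)

lemma integral_lebesgue_on_indicator:
  fixes h :: "real \<Rightarrow> 'a::euclidean_space"
  assumes "S \<in> sets lebesgue"
  shows "(LINT u|lebesgue_on S. h u) = (LINT u|lebesgue. indicator S u *\<^sub>R h u)"
  using assms by (subst integral_restrict_space) auto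

lemma AE_lebesgue_on_subset:
  assumes "AE x in lebesgue_on T. P x" "S \<subseteq> T" "S \<in> sets lebesgue" "T \<in> sets lebesgue"
  shows "AE x in lebesgue_on S. P x"
  using assms by (auto simp: AE_restrict_space_iff elim: eventually_mono)

text \<open>On each compact interval the Lebesgue primitive agrees with the Henstock-Kurzweil
  indefinite integral, which is continuous. Continuity is local, so the half-line follows.\<close>

lemma primitive_of_continuous:
  fixes f :: "real \<Rightarrow> 'a::euclidean_space"
  assumes "primitive_of f' f"
  shows "continuous_on {0..} f"
proof -
  have cont: "continuous_on {0..b} f" for b
  proof (cases "b \<ge> 0")
    case True
    have int: "f' integrable_on {0..b}"
      using has_integral_integral_lebesgue_on[OF primitive_ofD(1)[OF assms True]] by auto
    have "continuous_on {0..b} (\<lambda>x. f 0 + integral {0..x} f')"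
      by (intro continuous_intros indefinite_integral_continuous_1 int)
    moreover have "f 0 + integral {0..x} f' = f x" if "x \<in> {0..b}" for x
      using primitive_ofD[OF assms, of x] that by (simp add: lebesgue_integral_eq_integral)
    ultimately show ?thesis by (rule continuous_on_eq)
  qed auto
  have "continuous (at x within {0..}) f" if "x \<ge> 0" for x
  proof -
    have "continuous (at x within {0..x+1}) f"
      using cont[of "x+1"] that by (simp add: continuous_on_eq_continuous_within)
    \<comment> \<open>The right end \<open>x+1\<close> keeps \<open>x\<close> away from the
      artificial boundary of the compact interval.\<close>
    moreover have "at x within {0..x+1} = at x within {0..}"
      by (rule at_within_nhd[of _ "{..<x+1}"]) (auto simp: that)
    ultimately show ?thesis by simp
  qed
  then show ?thesis
    by (simp add: continuous_on_eq_continuous_within)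
qed

lemma borel_measurable_lebesgue_continuous:
  fixes f :: "real \<Rightarrow> 'a::euclidean_space"
  assumes "continuous_on UNIV f"
  shows "f \<in> borel_measurable lebesgue"
  using continuous_imp_measurable_on_sets_lebesgue[OF assms] by simp

lemma borel_measurable_continuous_atLeast:
  fixes f :: "real \<Rightarrow> 'a::euclidean_space"
  assumes "continuous_on {0..} f"
  shows "f \<in> borel_measurable (lebesgue_on {0..t})" "f \<in> borel_measurable (lebesgue_on {0..})"
  using assms by (auto intro!: continuous_imp_measurable_on_sets_lebesgue elim: continuous_on_subset)

lemma integrable_mult_continuous:
  fixes f g :: "real \<Rightarrow> complex"
  assumes f: "integrable (lebesgue_on {0..t}) f" and g: "continuous_on {0..} g"
  shows "integrable (lebesgue_on {0..t}) (\<lambda>x. f x * g x)"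
proof -
  have "compact (g ` {0..t})"
    by (intro compact_continuous_image continuous_on_subset[OF g]) auto
  then obtain C where "\<And>x. x \<in> {0..t} \<Longrightarrow> norm (g x) \<le> C"
    using compact_imp_bounded bounded_iff by (metis imageI)
  then show ?thesis
    by (intro integrable_mult_bounded[OF f borel_measurable_continuous_atLeast(1)[OF g]]) simp
qed

text \<open>The square \<open>[0,t]\<^sup>2\<close> is split along its diagonal and Fubini's theorem is applied to the integral of \<open>f' u * g' v\<close> on one
  half. The half-open interval keeps the diagonal from being counted twice.\<close>

lemma primitive_of_mult:
  fixes f g :: "real \<Rightarrow> complex"
  assumes f: "primitive_of f' f" and g: "primitive_of g' g"
  shows "primitive_of (\<lambda>s. f' s * g s + f s * g' s) (\<lambda>s. f s * g s)"
  unfolding primitive_of_def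
proof (intro allI impI)
  fix t :: real assume t: "t \<ge> 0"
  let ?M = "lebesgue_on {0..t}"
  have fi [simp]: "integrable ?M f'" and gi [simp]: "integrable ?M g'"
    using primitive_ofD(1) f g t by blast+
  have [measurable]: "f' \<in> borel_measurable ?M" "g' \<in> borel_measurable ?M"
    by (rule borel_measurable_integrable[OF fi], rule borel_measurable_integrable[OF gi])
  have fg: "integrable ?M (\<lambda>s. f' s * g s)"
    by (rule integrable_mult_continuous[OF fi primitive_of_continuous[OF g]])
  have gf: "integrable ?M (\<lambda>s. f s * g' s)"
    using integrable_mult_continuous[OF gi primitive_of_continuous[OF f]] by (simp add: mult.commute)
  interpret finite_measure ?M by (rule finite_measure_lebesgue_on) simp
  interpret P: pair_sigma_finite ?M ?M
    by unfold_locales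
  \<comment> \<open>Measurability of the coordinates makes the triangle \<open>u < v\<close>
    measurable in the product space.\<close>
  have idm [measurable]: "(\<lambda>x. x) \<in> borel_measurable ?M"
    by (rule borel_measurable_continuous_atLeast) (rule continuous_on_id)
  \<comment> \<open>The integrand on the open triangle above the diagonal. Integrating out
    \<open>u\<close> leaves \<open>F v * g' v\<close>; the complementary closed triangle contributes
    \<open>f' u * G u\<close>.\<close>
  define k where "k u v = (if u < v then f' u * g' v else 0)" for u v
  have kint: "integrable (?M \<Otimes>\<^sub>M ?M) (case_prod k)"
  proof (rule P.Fubini_integrable)
    show m: "case_prod k \<in> borel_measurable (?M \<Otimes>\<^sub>M ?M)"
      unfolding k_def by measurable
    have kv: "integrable ?M (\<lambda>v. k u v)" if "u \<in> {0..t}" for u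
    proof -
      have "integrable ?M (\<lambda>v. (f' u * g' v) * (if u < v then 1 else 0))"
        by (rule integrable_mult_bounded[where C=1]) auto
      then show ?thesis by (rule Bochner_Integration.integrable_cong[THEN iffD1, rotated 2]) (auto simp: k_def)
    qed
    then show "AE u in ?M. integrable ?M (\<lambda>v. case_prod k (u, v))"
      by (intro AE_I2) simp
    \<comment> \<open>Fubini's hypothesis: dropping the restriction \<open>u < v\<close> bounds the
      inner integral by \<open>norm (f' u)\<close> times the L1 norm of \<open>g'\<close>.\<close>
    show "integrable ?M (\<lambda>u. LINT v|?M. norm (case_prod k (u, v)))"
    proof (rule Bochner_Integration.integrable_bound)
      show "integrable ?M (\<lambda>u. norm (f' u) * (LINT v|?M. norm (g' v)))"
        by simp
      show "(\<lambda>u. LINT v|?M. norm (case_prod k (u, v))) \<in> borel_measurable ?M"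
        using m by measurable
      show "AE u in ?M. norm (LINT v|?M. norm (case_prod k (u, v))) \<le>
              norm (norm (f' u) * (LINT v|?M. norm (g' v)))"
      proof (rule AE_I2)
        fix u assume "u \<in> space ?M"
        then have "(LINT v|?M. norm (k u v)) \<le> (LINT v|?M. norm (f' u * g' v))"
          by (intro integral_mono integrable_norm kv) (auto simp: k_def)
        then show "norm (LINT v|?M. norm (case_prod k (u, v))) \<le>
              norm (norm (f' u) * (LINT v|?M. norm (g' v)))"
          by (simp add: norm_mult)
      qed
    qed
  qed
  define F where "F s = f s - f 0" for s
  define G where "G s = g s - g 0" for s
  have Gle: "G u = (LINT v|?M. indicator {0..u} v *\<^sub>R g' v)" if "u \<in> {0..t}" for u
  proof -
    have "g u = g 0 + (LINT v|lebesgue_on {0..u}. g' v)"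
      using that by (intro primitive_ofD(2)[OF g]) simp
    moreover have "(LINT v|lebesgue_on {0..u}. g' v) = (LINT v|?M. indicator {0..u} v *\<^sub>R g' v)"
      using that by (intro integral_lebesgue_on_subset) auto
    ultimately show ?thesis unfolding G_def by simp
  qed
  have Flt: "F v = (LINT u|?M. indicator {0..<v} u *\<^sub>R f' u)" if v: "v \<in> {0..t}" for v
  proof -
    have "f v = f 0 + (LINT u|lebesgue_on {0..v}. f' u)"
      using v by (intro primitive_ofD(2)[OF f]) simp
    moreover have "(LINT u|lebesgue_on {0..v}. f' u) = (LINT u|?M. indicator {0..v} u *\<^sub>R f' u)"
      using v by (intro integral_lebesgue_on_subset) auto
    ultimately have "F v = (LINT u|?M. indicator {0..v} u *\<^sub>R f' u)"
      unfolding F_def by simp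
    \<comment> \<open>The endpoint \<open>v\<close> is a null set. Removing it matches the strict
      inequality in \<open>k\<close>.\<close>
    also have "\<dots> = (LINT u|?M. indicator {0..<v} u *\<^sub>R f' u)"
    proof (rule integral_cong_AE)
      have "AE u in lebesgue. u \<noteq> v"
        by (intro AE_completion AE_lborel_singleton)
      then have "AE u in ?M. u \<noteq> v"
        by (subst AE_restrict_space_iff) auto
      then show "AE u in ?M. indicator {0..v} u *\<^sub>R f' u = indicator {0..<v} u *\<^sub>R f' u"
        by eventually_elim (auto simp: indicator_def)
    qed (intro borel_measurable_integrable integrable_lebesgue_on_indicator fi; simp)+
    finally show ?thesis .
  qed
  have "(LINT u|?M. f' u) * (LINT v|?M. g' v) = (LINT u|?M. f' u * (LINT v|?M. g' v))"
    by simp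
  also have "\<dots> = (LINT u|?M. f' u * G u + (LINT v|?M. k u v))"
  proof (rule Bochner_Integration.integral_cong)
    fix u assume u: "u \<in> space ?M"
    then have u: "u \<in> {0..t}" by simp
    have i1: "integrable ?M (\<lambda>v. indicator {0..u} v *\<^sub>R g' v)"
      and i2: "integrable ?M (\<lambda>v. indicator {u<..} v *\<^sub>R g' v)"
      by (intro integrable_lebesgue_on_indicator gi; simp)+
    have "(LINT v|?M. g' v) = (LINT v|?M. indicator {0..u} v *\<^sub>R g' v + indicator {u<..} v *\<^sub>R g' v)"
      by (rule Bochner_Integration.integral_cong) (auto simp: indicator_def)
    also have "\<dots> = G u + (LINT v|?M. indicator {u<..} v *\<^sub>R g' v)"
      using i1 i2 Gle[OF u] by simp
    finally have "f' u * (LINT v|?M. g' v) = f' u * G u + (LINT v|?M. f' u * (indicator {u<..} v *\<^sub>R g' v))"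
      by (simp only: distrib_left integral_mult_right_zero)
    also have "(LINT v|?M. f' u * (indicator {u<..} v *\<^sub>R g' v)) = (LINT v|?M. k u v)"
      by (rule Bochner_Integration.integral_cong) (auto simp: k_def indicator_def)
    finally show "f' u * (LINT v|?M. g' v) = f' u * G u + (LINT v|?M. k u v)" .
  qed simp
  also have "\<dots> = (LINT u|?M. f' u * G u) + (LINT u|?M. LINT v|?M. k u v)"
  proof (rule Bochner_Integration.integral_add)
    show "integrable ?M (\<lambda>u. f' u * G u)"
      using fg by (simp add: G_def algebra_simps)
    show "integrable ?M (\<lambda>u. LINT v|?M. k u v)"
      using P.integrable_fst[OF kint] .
  qed
  also have "(LINT u|?M. LINT v|?M. k u v) = (LINT v|?M. LINT u|?M. k u v)"
    using P.Fubini_integral[OF kint] by simp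
  also have "\<dots> = (LINT v|?M. F v * g' v)"
  proof (rule Bochner_Integration.integral_cong)
    fix v assume v: "v \<in> space ?M"
    then have v: "v \<in> {0..t}" by simp
    have "(LINT u|?M. k u v) = (LINT u|?M. (indicator {0..<v} u *\<^sub>R f' u) * g' v)"
      by (rule Bochner_Integration.integral_cong) (auto simp: k_def indicator_def)
    also have "\<dots> = F v * g' v"
      unfolding Flt[OF v] by (rule integral_mult_left_zero)
    finally show "(LINT u|?M. k u v) = F v * g' v" .
  qed simp
  \<comment> \<open>Subtracting the initial values in \<open>F\<close> and \<open>G\<close> leaves
    two boundary terms, which cancel when \<open>f t * g t\<close> is multiplied out.\<close>
  also have "(LINT u|?M. f' u * G u) + (LINT v|?M. F v * g' v)
     = (LINT u|?M. f' u * g u + f u * g' u) - g 0 * (LINT u|?M. f' u) - f 0 * (LINT u|?M. g' u)"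
    using fg gf by (simp add: F_def G_def algebra_simps)
  finally have *: "(LINT u|?M. f' u) * (LINT v|?M. g' v) =
     (LINT u|?M. f' u * g u + f u * g' u) - g 0 * (LINT u|?M. f' u) - f 0 * (LINT u|?M. g' u)" .
  have "f t = f 0 + (LINT u|?M. f' u)" "g t = g 0 + (LINT u|?M. g' u)"
    using primitive_ofD(2)[OF f t] primitive_ofD(2)[OF g t] by auto
  then have "f t * g t = f 0 * g 0 + g 0 * (LINT u|?M. f' u) + f 0 * (LINT u|?M. g' u)
     + (LINT u|?M. f' u) * (LINT u|?M. g' u)"
    by (simp only: algebra_simps)
  with * have "f t * g t = f 0 * g 0 + (LINT u|?M. f' u * g u + f u * g' u)"
    by simp
  with fg gf show "integrable ?M (\<lambda>s. f' s * g s + f s * g' s) \<and>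
       f t * g t = f 0 * g 0 + (LINT s|?M. f' s * g s + f s * g' s)"
    by (simp only: Bochner_Integration.integrable_add simp_thms)
qed

text \<open>At \<open>t = 0\<close> the integral runs over a null set, which identifies
  \<open>c\<close> with \<open>f 0\<close>. The initial value therefore need not be computed in
  advance.\<close>

lemma primitive_ofI:
  fixes f :: "real \<Rightarrow> 'a::euclidean_space"
  assumes "\<And>t. t \<ge> 0 \<Longrightarrow> integrable (lebesgue_on {0..t}) f'"
    and eq: "\<And>t. t \<ge> 0 \<Longrightarrow> f t = c + (LINT s|lebesgue_on {0..t}. f' s)"
  shows "primitive_of f' f"
proof -
  have "(LINT s|lebesgue_on {0..0}. f' s) = 0"
    using assms(1)[of 0] by (subst lebesgue_integral_eq_integral) auto
  then have "f 0 = c" using eq[of 0] by simp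
  then show ?thesis unfolding primitive_of_def using assms by simp
qed

lemma primitive_of_bounded_linear:
  assumes T: "bounded_linear T" and f: "primitive_of f' f"
  shows "primitive_of (\<lambda>s. T (f' s)) (\<lambda>s. T (f s))"
  unfolding primitive_of_def
proof (intro allI impI conjI)
  interpret bounded_linear T by fact
  fix t :: real assume t: "t \<ge> 0"
  note f' = primitive_ofD[OF f t]
  show "integrable (lebesgue_on {0..t}) (\<lambda>s. T (f' s))"
    by (rule integrable_bounded_linear[OF T f'(1)])
  show "T (f t) = T (f 0) + (LINT s|lebesgue_on {0..t}. T (f' s))"
    unfolding integral_bounded_linear[OF T f'(1)] f'(2) by (rule add)
qed

lemma primitive_of_add:
  assumes f: "primitive_of f' f" and g: "primitive_of g' g"
  shows "primitive_of (\<lambda>s. f' s + g' s) (\<lambda>s. f s + g s)"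
  unfolding primitive_of_def
proof (intro allI impI conjI)
  fix t :: real assume t: "t \<ge> 0"
  note f = primitive_ofD[OF f t] and g = primitive_ofD[OF g t]
  show "integrable (lebesgue_on {0..t}) (\<lambda>s. f' s + g' s)"
    using f(1) g(1) by simp
  show "f t + g t = f 0 + g 0 + (LINT s|lebesgue_on {0..t}. f' s + g' s)"
    using f g by simp
qed

lemma primitive_of_exp:
  fixes c :: complex
  shows "primitive_of (\<lambda>s. c * exp (c * of_real s)) (\<lambda>s. exp (c * of_real s))"
proof (rule primitive_ofI)
  fix t :: real assume t: "t \<ge> 0"
  let ?f = "\<lambda>s::real. c * exp (c * of_real s)"
  show i: "integrable (lebesgue_on {0..t}) ?f"
    by (intro continuous_imp_integrable_real continuous_intros)
  have "(?f has_integral exp (c * of_real t) - exp (c * of_real 0)) {0..t}"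
  proof (rule fundamental_theorem_of_calculus[OF t])
    fix x
    show "((\<lambda>s. exp (c * of_real s)) has_vector_derivative ?f x) (at x within {0..t})"
      by (rule has_vector_derivative_eq_rhs, rule field_vector_diff_chain_within[unfolded o_def, where f="\<lambda>s. c * of_real s" and g=exp and f'=c])
         (auto intro!: derivative_eq_intros)
  qed
  then have "integral {0..t} ?f = exp (c * of_real t) - exp (c * of_real 0)"
    by (rule integral_unique)
  then have "integral\<^sup>L (lebesgue_on {0..t}) ?f = exp (c * of_real t) - exp (c * of_real 0)"
    by (subst lebesgue_integral_eq_integral[OF i]) auto
  then show "exp (c * of_real t) = exp (c * of_real 0) + integral\<^sup>L (lebesgue_on {0..t}) ?f"
    by (simp only: add_diff_cancel_left' add_diff_eq)
qed

subsection \<open>A Volterra system with integrable kernels\<close>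

text \<open>Dominated convergence with majorant \<open>norm (h u)\<close>: as the parameter tends to
  \<open>x\<close>, the indicators converge at every \<open>u\<close> except possibly the null point
  \<open>u = x\<close>.\<close>

lemma continuous_integral_moving_set:
  fixes h :: "real \<Rightarrow> complex"
  assumes h: "integrable lebesgue h"
    and S: "\<And>x. S x \<in> sets lebesgue"
    and lim: "\<And>x u. u \<noteq> x \<Longrightarrow> isCont (\<lambda>y. indicat_real (S y) u) x"
  shows "continuous_on UNIV (\<lambda>x. LINT u|lebesgue. indicator (S x) u *\<^sub>R h u)"
  unfolding continuous_on_sequentially comp_def
proof (intro ballI allI impI, elim conjE)
  fix x and X :: "nat \<Rightarrow> real" assume X: "X \<longlonglongrightarrow> x"
  show "(\<lambda>n. LINT u|lebesgue. indicator (S (X n)) u *\<^sub>R h u) \<longlonglongrightarrow>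
     (LINT u|lebesgue. indicator (S x) u *\<^sub>R h u)"
  proof (rule integral_dominated_convergence[where w="\<lambda>u. norm (h u)"])
    have hi: "integrable lebesgue (\<lambda>u. indicator (S x) u *\<^sub>R h u)" for x
      by (rule integrable_mult_indicator[OF S h])
    show "(\<lambda>u. indicator (S x) u *\<^sub>R h u) \<in> borel_measurable lebesgue"
      and "\<And>n. (\<lambda>u. indicator (S (X n)) u *\<^sub>R h u) \<in> borel_measurable lebesgue"
      by (rule borel_measurable_integrable[OF hi])+
    show "integrable lebesgue (\<lambda>u. norm (h u))" using h by simp
    have "AE u in lebesgue. u \<noteq> x"
      by (intro AE_completion AE_lborel_singleton)
    then show "AE u in lebesgue. (\<lambda>n. indicator (S (X n)) u *\<^sub>R h u) \<longlonglongrightarrow> indicator (S x) u *\<^sub>R h u"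
    proof eventually_elim
      case (elim u)
      then have "isCont (\<lambda>y. indicat_real (S y) u) x" using lim by blast
      then have "(\<lambda>n. indicat_real (S (X n)) u) \<longlonglongrightarrow> indicator (S x) u"
        using X by (rule isCont_tendsto_compose)
      then show ?case by (intro tendsto_intros)
    qed
  qed (auto simp: indicator_def)
qed

text \<open>If \<open>u\<close> differs from \<open>x\<close>, the comparisons of \<open>y\<close>
  with \<open>u\<close> have constant truth value for \<open>y\<close> near \<open>x\<close>, so
  both indicators are locally constant there.\<close>

lemma isCont_indicator_interval_endpoint:
  fixes u x :: real
  assumes "u \<noteq> x"
  shows "isCont (\<lambda>y. indicat_real {y<..} u) x" "isCont (\<lambda>y. indicat_real {0..y} u) x"
proof -
  have "\<forall>\<^sub>F y in nhds x. (y < u) = (x < u) \<and> (u \<le> y) = (u \<le> x)"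
  proof (cases "u < x")
    case True
    then have "\<forall>\<^sub>F y in nhds x. y \<in> {u<..}"
      by (intro eventually_nhds_in_open open_greaterThan) auto
    then show ?thesis by eventually_elim (use True in auto)
  next
    case False
    then have "\<forall>\<^sub>F y in nhds x. y \<in> {..<u}"
      using assms by (intro eventually_nhds_in_open open_lessThan) auto
    then show ?thesis by eventually_elim (use False assms in auto)
  qed
  then have "\<forall>\<^sub>F y in nhds x. indicat_real {y<..} u = indicat_real {x<..} u \<and>
     indicat_real {0..y} u = indicat_real {0..x} u"
    by eventually_elim (auto simp: indicator_def)
  then show "isCont (\<lambda>y. indicat_real {y<..} u) x" "isCont (\<lambda>y. indicat_real {0..y} u) x"
    by (auto simp: eventually_conj_iff isCont_cong)
qed

lemma norm_kernel_integral_le: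
  fixes k h :: "real \<Rightarrow> complex"
  assumes k: "integrable lebesgue k" and h: "h \<in> borel_measurable lebesgue"
    and S: "S \<in> sets lebesgue" and C: "\<And>u. norm (h u) \<le> C"
  shows "norm (LINT u|lebesgue. indicator S u *\<^sub>R (k u * h u)) \<le> (LINT u|lebesgue. norm (k u)) * C"
proof -
  have C0: "C \<ge> 0" using C[of 0] norm_ge_zero order_trans by blast
  have kh: "integrable lebesgue (\<lambda>u. k u * h u)"
    by (rule integrable_mult_bounded[OF k h C])
  have "norm (LINT u|lebesgue. indicator S u *\<^sub>R (k u * h u)) \<le> (LINT u|lebesgue. norm (k u) * C)"
  proof (rule Bochner_Integration.integral_norm_bound_integral)
    show "integrable lebesgue (\<lambda>u. indicator S u *\<^sub>R (k u * h u))"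
      by (rule integrable_mult_indicator[OF S kh])
    show "integrable lebesgue (\<lambda>u. norm (k u) * C)" using k by simp
    show "norm (indicator S u *\<^sub>R (k u * h u)) \<le> norm (k u) * C" for u
      using C[of u] C0 by (auto simp: indicator_def norm_mult mult_left_mono)
  qed
  then show ?thesis by simp
qed

text \<open>The modulus of the exponential is \<open>exp (Re c * s)\<close>, at most
  \<open>exp (y * \<Lambda>)\<close> on the support of \<open>h\<close>. Bounding the absolute value
  of \<open>Re c\<close> lets one statement serve both \<open>c = \<i> * z\<close> and
  \<open>c = - (\<i> * z)\<close>.\<close>

lemma exp_kernel:
  fixes h :: "real \<Rightarrow> complex" and c :: complex
  assumes h: "integrable lebesgue h" and supp: "\<And>s. s \<notin> {0..\<Lambda>} \<Longrightarrow> h s = 0"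
    and c: "\<bar>Re c\<bar> \<le> y"
  shows "integrable lebesgue (\<lambda>s. h s * exp (c * of_real s))"
    and "(LINT s|lebesgue. norm (h s * exp (c * of_real s))) \<le> exp (y * \<Lambda>) * (LINT s|lebesgue. norm (h s))"
proof -
  have bd: "norm (h s * exp (c * of_real s)) \<le> exp (y * \<Lambda>) * norm (h s)" for s
  proof (cases "s \<in> {0..\<Lambda>}")
    case True
    have "Re c * s \<le> y * \<Lambda>"
      by (rule order_trans[of _ "y * s"]) (use True c in \<open>auto intro: mult_right_mono mult_left_mono\<close>)
    then have "norm (exp (c * of_real s)) \<le> exp (y * \<Lambda>)"
      by (simp add: norm_exp_eq_Re)
    then show ?thesis
      by (simp add: norm_mult mult.commute[of "norm (h s)"] mult_right_mono)
  qed (simp add: supp)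
  have hi: "integrable lebesgue (\<lambda>s. exp (y * \<Lambda>) * norm (h s))"
    using h by simp
  show int: "integrable lebesgue (\<lambda>s. h s * exp (c * of_real s))"
  proof (rule Bochner_Integration.integrable_bound[OF hi])
    show "(\<lambda>s. h s * exp (c * of_real s)) \<in> borel_measurable lebesgue"
      by (intro borel_measurable_times borel_measurable_integrable[OF h]
          borel_measurable_lebesgue_continuous continuous_intros)
    show "AE s in lebesgue. norm (h s * exp (c * of_real s)) \<le> norm (exp (y * \<Lambda>) * norm (h s))"
      using bd by (simp add: abs_mult)
  qed
  have "(LINT s|lebesgue. norm (h s * exp (c * of_real s))) \<le> (LINT s|lebesgue. exp (y * \<Lambda>) * norm (h s))"
    using bd by (intro integral_mono integrable_norm int hi)
  then show "(LINT s|lebesgue. norm (h s * exp (c * of_real s))) \<le> exp (y * \<Lambda>) * (LINT s|lebesgue. norm (h s))"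
    by simp
qed

text \<open>Eliminating the second unknown by B = V A leaves the single equation A = 1 + U (V A) on
  bounded continuous functions. The composite of U and V has norm at most \<open>N1 * N2\<close>, so
  Banach's fixed point theorem applies.\<close>

lemma volterra_pair_exists:
  fixes k1 k2 :: "real \<Rightarrow> complex"
  defines "N1 \<equiv> (LINT u|lebesgue. norm (k1 u))" and "N2 \<equiv> (LINT u|lebesgue. norm (k2 u))"
  assumes k1: "integrable lebesgue k1" and k2: "integrable lebesgue k2" and N: "N1 * N2 \<le> 1/2"
  obtains A B where "continuous_on UNIV A" "continuous_on UNIV B"
    "\<And>s. A s = 1 + (LINT u|lebesgue. indicator {0..s} u *\<^sub>R (k1 u * B u))"
    "\<And>s. B s = (LINT u|lebesgue. indicator {s<..} u *\<^sub>R (k2 u * A u))"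
    "\<And>s. norm (A s) \<le> 2" "\<And>s. norm (B s) \<le> N2 * 2"
proof -
  \<comment> \<open>\<open>V\<close> integrates from \<open>s\<close> to infinity and so builds in
    that B vanishes at infinity; \<open>U\<close> integrates from 0, where A is prescribed.\<close>
  define V where "V h s = (LINT u|lebesgue. indicator {s<..} u *\<^sub>R (k2 u * h u))" for h s
  define U where "U h s = (LINT u|lebesgue. indicator {0..s} u *\<^sub>R (k1 u * h u))" for h s
  have N0: "N1 \<ge> 0" "N2 \<ge> 0" by (simp_all add: N1_def N2_def)
  note meas = borel_measurable_lebesgue_continuous
  have Vc: "continuous_on UNIV (V h)" if "continuous_on UNIV h" "\<And>u. norm (h u) \<le> C" for h C
    unfolding V_def using that isCont_indicator_interval_endpoint
    by (intro continuous_integral_moving_set integrable_mult_bounded[OF k2 meas]) auto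
  have Uc: "continuous_on UNIV (U h)" if "continuous_on UNIV h" "\<And>u. norm (h u) \<le> C" for h C
    unfolding U_def using that isCont_indicator_interval_endpoint
    by (intro continuous_integral_moving_set integrable_mult_bounded[OF k1 meas]) auto
  have Vb: "norm (V h s) \<le> N2 * C" if "continuous_on UNIV h" "\<And>u. norm (h u) \<le> C" for h C s
    unfolding V_def N2_def by (rule norm_kernel_integral_le[OF k2 meas]) (use that in auto)
  have Ub: "norm (U h s) \<le> N1 * C" if "continuous_on UNIV h" "\<And>u. norm (h u) \<le> C" for h C s
    unfolding U_def N1_def by (rule norm_kernel_integral_le[OF k1 meas]) (use that in auto)
  have Ui: "integrable lebesgue (\<lambda>u. indicator {0..s} u *\<^sub>R (k1 u * h u))"
    if "continuous_on UNIV h" "\<And>u. norm (h u) \<le> C" for h C s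
    by (intro integrable_mult_indicator integrable_mult_bounded[OF k1 meas]) (use that in auto)
  have Vi: "integrable lebesgue (\<lambda>u. indicator {s<..} u *\<^sub>R (k2 u * h u))"
    if "continuous_on UNIV h" "\<And>u. norm (h u) \<le> C" for h C s
    by (intro integrable_mult_indicator integrable_mult_bounded[OF k2 meas]) (use that in auto)
  have Vd: "V f s - V g s = V (\<lambda>u. f u - g u) s" 
    if "continuous_on UNIV f" "\<And>u. norm (f u) \<le> C" "continuous_on UNIV g" "\<And>u. norm (g u) \<le> D" for f g C D s
    using Bochner_Integration.integral_diff[OF Vi[OF that(1,2)] Vi[OF that(3,4)], of s s]
    by (simp only: V_def right_diff_distrib scaleR_right_diff_distrib)
  have Ud: "U f s - U g s = U (\<lambda>u. f u - g u) s" 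
    if "continuous_on UNIV f" "\<And>u. norm (f u) \<le> C" "continuous_on UNIV g" "\<And>u. norm (g u) \<le> D" for f g C D s
    using Bochner_Integration.integral_diff[OF Ui[OF that(1,2)] Ui[OF that(3,4)], of s s]
    by (simp only: U_def right_diff_distrib scaleR_right_diff_distrib)
  have fc: "continuous_on UNIV (apply_bcontfun f)" for f :: "real \<Rightarrow>\<^sub>C complex" by simp
  note fb = norm_bounded
  define P where "P f = Bcontfun (\<lambda>s. 1 + U (V (apply_bcontfun f)) s)" for f :: "real \<Rightarrow>\<^sub>C complex"
  have P: "apply_bcontfun (P f) s = 1 + U (V (apply_bcontfun f)) s" for f s
  proof -
    \<comment> \<open>\<open>Bcontfun\<close> can be evaluated only on functions known to be bounded
      and continuous, so this must precede any use of \<open>P\<close>.\<close>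
    have "(\<lambda>s. 1 + U (V (apply_bcontfun f)) s) \<in> bcontfun"
    proof (rule bcontfun_normI)
      show "continuous_on UNIV (\<lambda>s. 1 + U (V (apply_bcontfun f)) s)"
        by (intro continuous_intros Uc[OF Vc[OF fc fb] Vb[OF fc fb]])
      show "norm (1 + U (V (apply_bcontfun f)) s) \<le> 1 + N1 * (N2 * norm f)" for s
        using Ub[OF Vc[OF fc fb] Vb[OF fc fb], of f s] norm_triangle_ineq[of 1 "U (V (apply_bcontfun f)) s"] by simp
    qed
    then show ?thesis by (simp add: P_def Bcontfun_inverse)
  qed
  have "\<exists>!f. P f = f"
  proof (rule banach_fix_type)
    show "0 \<le> N1 * N2" "N1 * N2 < 1" using N N0 by auto
    show "\<forall>f g. dist (P f) (P g) \<le> N1 * N2 * dist f g"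
    proof (intro allI dist_bound)
      fix f g :: "real \<Rightarrow>\<^sub>C complex" and s
      let ?d = "\<lambda>u. apply_bcontfun f u - apply_bcontfun g u"
      have dc: "continuous_on UNIV ?d" by (intro continuous_intros fc)
      have db: "norm (?d u) \<le> dist f g" for u
        using dist_bounded[of f u g] by (simp add: dist_norm)
      have "dist (P f s) (P g s) = norm (U (V f) s - U (V g) s)"
        by (simp add: P dist_norm)
      also have "U (V f) s - U (V g) s = U (\<lambda>u. V f u - V g u) s"
        by (rule Ud[OF Vc[OF fc fb] Vb[OF fc fb] Vc[OF fc fb] Vb[OF fc fb]])
      also have "(\<lambda>u. V f u - V g u) = V ?d"
        by (rule ext) (rule Vd[OF fc fb fc fb])
      also have "norm (U (V ?d) s) \<le> N1 * (N2 * dist f g)"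
        by (rule Ub[OF Vc[OF dc db] Vb[OF dc db]])
      finally show "dist (P f s) (P g s) \<le> N1 * N2 * dist f g"
        by simp
    qed
  qed
  then obtain f where f: "P f = f" by blast
  have eq: "apply_bcontfun f s = 1 + U (V (apply_bcontfun f)) s" for s
    using P[of f s] f by simp
  \<comment> \<open>A priori bound: the fixed point equation gives norm f at most 1 + (norm f) / 2,
    hence at most 2. The bound \<open>N2 * 2\<close> for the second function follows.\<close>
  have "norm f \<le> 1 + N1 * N2 * norm f"
  proof (rule norm_bound)
    fix s
    have "norm (apply_bcontfun f s) \<le> 1 + norm (U (V (apply_bcontfun f)) s)"
      unfolding eq[of s] using norm_triangle_ineq[of 1 "U (V (apply_bcontfun f)) s"] by simp
    also have "\<dots> \<le> 1 + N1 * (N2 * norm f)"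
      using Ub[OF Vc[OF fc fb] Vb[OF fc fb]] by simp
    finally show "norm (apply_bcontfun f s) \<le> 1 + N1 * N2 * norm f" by simp
  qed
  moreover have "N1 * N2 * norm f \<le> 1/2 * norm f"
    using N by (rule mult_right_mono) simp
  ultimately have f2: "norm f \<le> 2" by simp
  have b2: "norm (apply_bcontfun f s) \<le> 2" for s
    using fb[of f s] f2 by linarith
  show ?thesis
  proof (rule that[of "apply_bcontfun f" "V (apply_bcontfun f)"])
    show "apply_bcontfun f s = 1 + (LINT u|lebesgue. indicator {0..s} u *\<^sub>R (k1 u * V (apply_bcontfun f) u))" for s
      using eq[of s] unfolding U_def .
    show "V (apply_bcontfun f) s = (LINT u|lebesgue. indicator {s<..} u *\<^sub>R (k2 u * apply_bcontfun f u))" for s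
      unfolding V_def ..
    show "norm (V (apply_bcontfun f) s) \<le> N2 * 2" for s
      by (rule Vb[OF fc b2])
  qed (use b2 fc Vc[OF fc fb] in auto)
qed

subsection \<open>Square-integrable solutions of canonical systems\<close>

lemma canonical_solution_iff:
  "canonical_solution H z Y \<longleftrightarrow> (\<exists>Y'. primitive_of Y' Y \<and>
     (AE s in lebesgue_on {0..}. Jmat *v Y' s = z *s (cmat (H s) *v Y s)))"
  unfolding canonical_solution_def primitive_of_def ..

lemma cmat_nth [simp]: "cmat A $ i $ j = of_real (A $ i $ j)"
  by (simp add: cmat_def map_matrix_def)

text \<open>\<open>Jmat\<close> sends (d1, d2) to (-d2, d1), so the system can be solved for the
  derivative and used as a rewrite rule.\<close>

lemma canonical_equation_iff:
  "Jmat *v D = z *s (cmat A *v Y) \<longleftrightarrow>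
     D $ 1 = z * (of_real (A $ 2 $ 1) * Y $ 1 + of_real (A $ 2 $ 2) * Y $ 2) \<and>
     D $ 2 = - z * (of_real (A $ 1 $ 1) * Y $ 1 + of_real (A $ 1 $ 2) * Y $ 2)"
proof -
  have "Jmat *v D = z *s (cmat A *v Y) \<longleftrightarrow>
     - (D $ 2) = z * (of_real (A $ 1 $ 1) * Y $ 1 + of_real (A $ 1 $ 2) * Y $ 2) \<and>
     D $ 1 = z * (of_real (A $ 2 $ 1) * Y $ 1 + of_real (A $ 2 $ 2) * Y $ 2)"
    by (simp add: vec_eq_iff forall_2 matrix_vector_mult_def sum_2 Jmat_def)
  moreover have "- (D $ 2) = x \<longleftrightarrow> D $ 2 = - x" for x :: complex
    by (auto simp: minus_equation_iff)
  ultimately show ?thesis by (simp only: mult_minus_left conj_commute)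
qed

lemma herm_form_eq:
  "herm_form A Y = cnj (Y $ 1) * (of_real (A $ 1 $ 1) * Y $ 1 + of_real (A $ 1 $ 2) * Y $ 2)
     + cnj (Y $ 2) * (of_real (A $ 2 $ 1) * Y $ 1 + of_real (A $ 2 $ 2) * Y $ 2)"
  by (simp add: herm_form_def matrix_vector_mult_def sum_2)

lemma half_id_nth [simp]:
  "half_id $ 1 $ 1 = 1/2" "half_id $ 2 $ 2 = 1/2" "half_id $ 1 $ 2 = 0" "half_id $ 2 $ 1 = 0"
  by (simp_all add: half_id_def mat_def)

lemma herm_form_half_id: "herm_form half_id Y = of_real (((norm (Y $ 1))\<^sup>2 + (norm (Y $ 2))\<^sup>2) / 2)"
  unfolding herm_form_eq of_real_divide of_real_add complex_norm_square by (simp add: field_simps)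

text \<open>The integrals of \<open>norm c\<close> over intervals of length n are n times
  \<open>norm c\<close> and remain below one finite number; the Archimedean property forces
  \<open>c = 0\<close>.\<close>

lemma integrable_const_atLeast_imp_0:
  fixes c :: complex
  assumes "integrable (lebesgue_on {a..}) (\<lambda>_::real. c)"
  shows "c = 0"
proof -
  have "integrable (lebesgue_on {a..}) (\<lambda>_::real. norm c)"
    using assms by (rule integrable_norm)
  then have int: "(\<lambda>_::real. norm c) integrable_on {a..}"
    using has_integral_integral_lebesgue_on[of "{a..}" "\<lambda>_. norm c"] by auto
  have "of_nat n * norm c \<le> integral {a..} (\<lambda>_. norm c)" for n :: nat
  proof -
    have "integral {a..a + of_nat n} (\<lambda>_. norm c) \<le> integral {a..} (\<lambda>_. norm c)"
      by (rule integral_subset_le[OF _ _ int]) auto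
    then show ?thesis by simp
  qed
  then have "\<not> 0 < norm c"
    using reals_Archimedean3[of "norm c"] by (meson not_le)
  then show ?thesis by simp
qed

text \<open>As \<open>J H\<close> is traceless, the Wronskian of two solutions is constant. It is also
  dominated by \<open>Y\<^sup>* H Y + Z\<^sup>* H Z\<close> on the free tail, hence integrable there, hence zero.\<close>

lemma square_integrable_solutions_dependent:
  assumes sym: "\<And>s. s \<ge> 0 \<Longrightarrow> H s $ 1 $ 2 = H s $ 2 $ 1"
    and tail: "\<And>s. s \<ge> \<Lambda> \<Longrightarrow> H s = half_id" and \<Lambda>: "\<Lambda> \<ge> 0"
    and Y: "canonical_solution H z Y" "square_integrable H Y"
    and Z: "canonical_solution H z Z" "square_integrable H Z"
  shows "Y 0 $ 1 * Z 0 $ 2 = Y 0 $ 2 * Z 0 $ 1"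
proof -
  obtain Y' where Y': "primitive_of Y' Y"
    "AE s in lebesgue_on {0..}. Jmat *v Y' s = z *s (cmat (H s) *v Y s)"
    using Y(1) unfolding canonical_solution_iff by blast
  obtain Z' where Z': "primitive_of Z' Z"
    "AE s in lebesgue_on {0..}. Jmat *v Z' s = z *s (cmat (H s) *v Z s)"
    using Z(1) unfolding canonical_solution_iff by blast
  have Yi: "primitive_of (\<lambda>s. Y' s $ i) (\<lambda>s. Y s $ i)" for i
    by (rule primitive_of_bounded_linear[OF bounded_linear_vec_nth Y'(1)])
  have Zi: "primitive_of (\<lambda>s. Z' s $ i) (\<lambda>s. Z s $ i)" for i
    by (rule primitive_of_bounded_linear[OF bounded_linear_vec_nth Z'(1)])
  \<comment> \<open>The Wronskian is written as a sum with a negated term, so that its derivative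
    follows from the product rule, negation as a bounded linear map, and
    \<open>primitive_of_add\<close>.\<close>
  define W where "W s = Y s $ 1 * Z s $ 2 + - (Y s $ 2 * Z s $ 1)" for s
  define W' where "W' s = Y' s $ 1 * Z s $ 2 + Y s $ 1 * Z' s $ 2
     + - (Y' s $ 2 * Z s $ 1 + Y s $ 2 * Z' s $ 1)" for s
  have W: "primitive_of W' W"
    unfolding W_def[abs_def] W'_def[abs_def]
    by (intro primitive_of_add[OF primitive_of_mult[OF Yi Zi]
        primitive_of_bounded_linear[OF bounded_linear_minus[OF bounded_linear_ident]
          primitive_of_mult[OF Yi Zi]]])
  have W'0: "AE s in lebesgue_on {0..}. W' s = 0"
  proof -
    have "AE s in lebesgue_on {0..}. s \<ge> 0"
      by (rule AE_I2) simp
    with Y'(2) Z'(2) show ?thesis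
    proof eventually_elim
      case (elim s)
      note Y's = elim(1)[unfolded canonical_equation_iff] and Z's = elim(2)[unfolded canonical_equation_iff]
      \<comment> \<open>The diagonal entries of \<open>H s\<close> cancel; only the difference of
        the off-diagonal entries remains, and symmetry removes it.\<close>
      have "W' s = z * (of_real (H s $ 2 $ 1) - of_real (H s $ 1 $ 2)) * (Y s $ 1 * Z s $ 2 - Y s $ 2 * Z s $ 1)"
        unfolding W'_def Y's[THEN conjunct1] Y's[THEN conjunct2] Z's[THEN conjunct1] Z's[THEN conjunct2]
        by (simp add: algebra_simps)
      then show ?case using sym[OF elim(3)] by simp
    qed
  qed
  have Wc: "W t = W 0" if "t \<ge> 0" for t
  proof -
    have "AE s in lebesgue_on {0..t}. W' s = 0"
      by (rule AE_lebesgue_on_subset[OF W'0]) auto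
    then have "(LINT s|lebesgue_on {0..t}. W' s) = 0"
      by (rule integral_eq_zero_AE)
    then show ?thesis using primitive_ofD(2)[OF W that] by simp
  qed
  have int: "integrable (lebesgue_on {\<Lambda>..}) (\<lambda>s. of_real (((norm (X s $ 1))\<^sup>2 + (norm (X s $ 2))\<^sup>2) / 2) :: complex)"
    if "square_integrable H X" for X
  proof -
    have "integrable (lebesgue_on {\<Lambda>..}) (\<lambda>s. herm_form (H s) (X s))"
      by (rule integrable_lebesgue_on_subset[of "{0..}"]) (use that \<Lambda> in \<open>auto simp: square_integrable_def\<close>)
    then show ?thesis
      by (rule Bochner_Integration.integrable_cong[THEN iffD1, rotated 2])
        (auto simp: tail herm_form_half_id)
  qed
  have "integrable (lebesgue_on {\<Lambda>..}) (\<lambda>_::real. W 0)"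
  proof (rule Bochner_Integration.integrable_bound[OF
        Bochner_Integration.integrable_add[OF int[OF Y(2)] int[OF Z(2)]]], simp, rule AE_I2)
    fix s assume "s \<in> space (lebesgue_on {\<Lambda>..})"
    then have s: "s \<ge> 0" using \<Lambda> by simp
    let ?n = "\<lambda>X. ((norm (X s $ 1))\<^sup>2 + (norm (X s $ 2))\<^sup>2) / 2"
    have "norm (W 0) = norm (Y s $ 1 * Z s $ 2 - Y s $ 2 * Z s $ 1)"
      using Wc[OF s] by (simp add: W_def)
    also have "\<dots> \<le> norm (Y s $ 1) * norm (Z s $ 2) + norm (Y s $ 2) * norm (Z s $ 1)"
      by (rule order_trans[OF norm_triangle_ineq4]) (simp add: norm_mult)
    \<comment> \<open>The inequality 2ab \<le> a^2 + b^2 is applied to each of the two crossed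
      products.\<close>
    also have "\<dots> \<le> ?n Y + ?n Z"
      using sum_squares_bound[of "norm (Y s $ 1)" "norm (Z s $ 2)"]
        sum_squares_bound[of "norm (Y s $ 2)" "norm (Z s $ 1)"] by (simp add: field_simps)
    also have "\<dots> = norm (of_real (?n Y) + of_real (?n Z) :: complex)"
      by (simp only: of_real_add[symmetric] norm_of_real) simp
    finally show "norm (W 0) \<le> norm (of_real (?n Y) + of_real (?n Z) :: complex)" .
  qed
  then have "W 0 = 0" by (rule integrable_const_atLeast_imp_0)
  then show ?thesis by (simp add: W_def)
qed

text \<open>It suffices to exhibit one square-integrable solution. For a competitor with the same
  first component 1 at 0, the vanishing Wronskian equates the second components, which gives the
  uniqueness required by \<open>THE\<close>.\<close>

lemma weyl_coeff_eqI:
  assumes "\<Lambda> \<ge> 0" and sym: "\<And>s. H s $ 1 $ 2 = H s $ 2 $ 1"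
    and Y: "canonical_solution (free_tail \<Lambda> H) z Y" "Y 0 = vector [1, m]"
      "square_integrable (free_tail \<Lambda> H) Y"
  shows "weyl_coeff H \<Lambda> z = m"
  unfolding weyl_coeff_def
proof (rule the_equality)
  show "\<exists>Y. canonical_solution (free_tail \<Lambda> H) z Y \<and> Y 0 = vector [1, m] \<and>
      square_integrable (free_tail \<Lambda> H) Y"
    using Y by blast
  fix m' assume "\<exists>Y. canonical_solution (free_tail \<Lambda> H) z Y \<and> Y 0 = vector [1, m'] \<and>
      square_integrable (free_tail \<Lambda> H) Y"
  then obtain Z where Z: "canonical_solution (free_tail \<Lambda> H) z Z" "Z 0 = vector [1, m']"
    "square_integrable (free_tail \<Lambda> H) Z"
    by blast
  have "Y 0 $ 1 * Z 0 $ 2 = Y 0 $ 2 * Z 0 $ 1"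
    by (rule square_integrable_solutions_dependent[where H="free_tail \<Lambda> H" and \<Lambda>=\<Lambda> and z=z])
      (use assms Z in \<open>auto simp: free_tail_def\<close>)
  then show "m' = m" by (simp add: Y Z)
qed

subsection \<open>Perturbations of the free Hamiltonian\<close>

text \<open>The columns of \<open>Xmat w\<close> are orthogonal and both have length
  \<open>norm w\<close>, so every vector is stretched by exactly that factor. This turns
  \<open>L1_op\<close> into the L1 norm of \<open>q\<close>.\<close>

lemma op_norm_Xmat: "op_norm (Xmat w) = norm w"
proof -
  have eq: "norm (Xmat w *v x) = norm w * norm x" for x
  proof -
    have "(norm (Xmat w *v x))\<^sup>2 = (norm w * norm x)\<^sup>2"
      by (simp only: power2_norm_eq_inner power_mult_distrib inner_vec_def sum_2 matrix_vector_mult_def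
          vec_lambda_beta inner_real_def Xmat_nth inner_complex_def)
        (simp add: algebra_simps power2_eq_square)
    then show ?thesis by simp
  qed
  have "op_norm (Xmat w) \<le> norm w"
    unfolding op_norm_def by (rule onorm_le) (simp add: eq)
  moreover have "norm w * norm (axis 1 1 :: real^2) \<le> op_norm (Xmat w) * norm (axis 1 1 :: real^2)"
    unfolding op_norm_def eq[symmetric] by (rule onorm) (rule matrix_vector_mul_bounded_linear)
  ultimately show ?thesis by simp
qed

lemma half_id_plus_Xmat_nth:
  "(half_id + Xmat w) $ 1 $ 1 = 1/2 + Re w" "(half_id + Xmat w) $ 1 $ 2 = Im w"
  "(half_id + Xmat w) $ 2 $ 1 = Im w" "(half_id + Xmat w) $ 2 $ 2 = 1/2 - Re w"
  by simp_all

text \<open>A crude bound suffices: every entry of the matrix has modulus at most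
  \<open>1/2 + norm w\<close>.\<close>

lemma norm_herm_form_le:
  "norm (herm_form (half_id + Xmat w) Y) \<le> (1/2 + norm w) * (norm (Y $ 1) + norm (Y $ 2))\<^sup>2"
proof -
  let ?c = "1/2 + norm w" and ?u = "norm (Y $ 1)" and ?v = "norm (Y $ 2)"
  have le: "\<bar>Re w\<bar> \<le> norm w" "\<bar>Im w\<bar> \<le> norm w" by (rule abs_Re_le_cmod abs_Im_le_cmod)+
  have row: "norm (complex_of_real x * Y $ 1 + complex_of_real y * Y $ 2) \<le> ?c * (?u + ?v)"
    if "\<bar>x\<bar> \<le> ?c" "\<bar>y\<bar> \<le> ?c" for x y
  proof -
    have "norm (complex_of_real x * Y $ 1 + complex_of_real y * Y $ 2) \<le> \<bar>x\<bar> * ?u + \<bar>y\<bar> * ?v"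
      by (rule order_trans[OF norm_triangle_ineq]) (simp add: norm_mult)
    also have "\<dots> \<le> ?c * ?u + ?c * ?v"
      by (intro add_mono mult_right_mono that) auto
    finally show ?thesis by (simp add: algebra_simps)
  qed
  have "norm (herm_form (half_id + Xmat w) Y) \<le> ?u * (?c * (?u + ?v)) + ?v * (?c * (?u + ?v))"
    unfolding herm_form_eq half_id_plus_Xmat_nth
    by (rule order_trans[OF norm_triangle_ineq], rule add_mono; simp only: norm_mult complex_mod_cnj,
        rule mult_left_mono[OF row]) (use le in auto)
  then show ?thesis by (simp add: power2_eq_square algebra_simps)
qed

lemma integrable_exp_minus:
  assumes "a > 0"
  shows "integrable (lebesgue_on {0..}) (\<lambda>s::real. exp (- a * s))"
proof -
  have "(\<lambda>s. exp (- a * s)) absolutely_integrable_on {0..}"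
    by (rule nonnegative_absolutely_integrable_1[OF integrable_on_exp_minus_to_infinity[OF assms]]) simp
  then show ?thesis
    by (simp add: integrable_restrict_space set_integrable_def)
qed

text \<open>Variation of constants with modes \<open>e\<close> and \<open>f\<close>. The growing
  mode \<open>f\<close> carries the coefficient \<open>B\<close>, which vanishes beyond
  \<open>\<Lambda>\<close>; hence the solution is bounded by a constant times the decaying
  mode.\<close>

lemma decaying_solution_exists:
  fixes A B p :: "real \<Rightarrow> complex"
  assumes z: "Im z > 0"
    and A: "primitive_of (\<lambda>s. \<i> * z * cnj (p s) * exp (- (\<i> * z * of_real s)) * B s) A"
    and B: "primitive_of (\<lambda>s. - (\<i> * z * p s * exp (\<i> * z * of_real s) * A s)) B"
    and tail: "\<And>s. s \<ge> \<Lambda> \<Longrightarrow> B s = 0"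
    and bA: "\<And>s. norm (A s) \<le> cA" and bB: "\<And>s. norm (B s) \<le> cB"
    and p: "p \<in> borel_measurable (lebesgue_on {0..})" "AE s in lebesgue_on {0..}. norm (p s) \<le> M"
    and H: "\<And>s. s \<ge> 0 \<Longrightarrow> H s = half_id + Xmat (p s)"
  shows "\<exists>Y. canonical_solution H z Y \<and> square_integrable H Y \<and>
     Y 0 = vector [A 0 + B 0, \<i> * (A 0 - B 0)]"
proof -
  \<comment> \<open>With \<open>k\<close> equal to \<open>\<i>\<close> or \<open>- \<i>\<close>,
    \<open>T k\<close> embeds a scalar along an eigenvector of \<open>Jmat\<close>.\<close>
  define T :: "complex \<Rightarrow> complex \<Rightarrow> complex^2" where "T k c = vector [c, k * c]" for k c
  have T: "bounded_linear (T k)" for k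
    unfolding linear_conv_bounded_linear[symmetric]
    by (rule linearI) (simp_all add: T_def vec_eq_iff forall_2 algebra_simps)
  have Tn [simp]: "T k c $ 1 = c" "T k c $ 2 = k * c" for k c by (simp_all add: T_def)
  define e where "e s = exp (\<i> * z / 2 * of_real s)" for s :: real
  define f where "f s = exp (- (\<i> * z / 2) * of_real s)" for s :: real
  \<comment> \<open>The exponentials in the equations for \<open>A\<close> and \<open>B\<close>
    exchange the two modes, so \<open>Y' s\<close> involves only the products
    \<open>e s * A s\<close> and \<open>f s * B s\<close>.\<close>
  have ef: "e s * exp (- (\<i> * z * of_real s)) = f s" "f s * exp (\<i> * z * of_real s) = e s" for s
    unfolding e_def f_def exp_add[symmetric] by (auto intro!: arg_cong[where f=exp] simp: algebra_simps)
  define Y where "Y s = T \<i> (e s * A s) + T (- \<i>) (f s * B s)" for s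
  define Y' where "Y' s = T \<i> (\<i> * z / 2 * e s * A s +
        e s * (\<i> * z * cnj (p s) * exp (- (\<i> * z * of_real s)) * B s))
     + T (- \<i>) (- (\<i> * z / 2) * f s * B s + f s * - (\<i> * z * p s * exp (\<i> * z * of_real s) * A s))" for s
  have Y: "primitive_of Y' Y"
    unfolding Y_def[abs_def] Y'_def[abs_def] e_def f_def
    by (intro primitive_of_add primitive_of_bounded_linear[OF T] primitive_of_mult primitive_of_exp A B)
  have Y1: "Y s $ 1 = e s * A s + f s * B s" and Y2: "Y s $ 2 = \<i> * (e s * A s) - \<i> * (f s * B s)" for s
    by (simp_all add: Y_def)
  have eqn: "Jmat *v Y' s = z *s (cmat (half_id + Xmat (p s)) *v Y s)" for s
  proof -
    \<comment> \<open>These abbreviations reduce the differential equation to a polynomial identity.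
      Taking \<open>h\<close> as half of \<open>z\<close> avoids fractions in the
      derivative.\<close>
    define a b where "a = e s * A s" and "b = f s * B s"
    define x y where "x = complex_of_real (Re (p s))" and "y = complex_of_real (Im (p s))"
    define h where "h = z / 2"
    have zh: "z = 2 * h" "z / 2 = h" by (simp_all add: h_def)
    have pc: "p s = x + \<i> * y" "cnj (p s) = x - \<i> * y"
      by (simp_all add: complex_eq_iff x_def y_def)
    have Ys: "Y s $ 1 = a + b" "Y s $ 2 = \<i> * (a - b)"
      by (simp_all add: Y1 Y2 a_def b_def algebra_simps)
    have 1: "e s * (\<i> * z * cnj (p s) * exp (- (\<i> * z * of_real s)) * B s) = \<i> * z * cnj (p s) * b"
      unfolding b_def ef(1)[symmetric] by (simp only: ac_simps)
    have 2: "f s * - (\<i> * z * p s * exp (\<i> * z * of_real s) * A s) = - (\<i> * z * p s * a)"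
      unfolding a_def ef(2)[symmetric] by (simp only: ac_simps mult_minus_right)
    have Y's: "Y' s $ 1 = \<i> * h * a + \<i> * (2 * h) * (x - \<i> * y) * b - \<i> * h * b - \<i> * (2 * h) * (x + \<i> * y) * a"
      "Y' s $ 2 = \<i> * (\<i> * h * a + \<i> * (2 * h) * (x - \<i> * y) * b + \<i> * h * b + \<i> * (2 * h) * (x + \<i> * y) * a)"
      unfolding Y'_def 1 2 unfolding pc(2) unfolding pc(1) zh(1)[symmetric]
      by (simp_all add: h_def a_def b_def algebra_simps)
    have ii: "\<i> * (\<i> * w) = - w" for w :: complex by (simp add: mult.assoc[symmetric])
    show ?thesis
      unfolding canonical_equation_iff half_id_plus_Xmat_nth Ys Y's zh(1) of_real_add of_real_diff
        x_def[symmetric] y_def[symmetric]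
      by (simp add: algebra_simps diff_divide_distrib ii)
  qed
  have "AE s in lebesgue_on {0..}. Jmat *v Y' s = z *s (cmat (H s) *v Y s)"
    by (rule AE_I2) (simp add: H eqn)
  with Y have "canonical_solution H z Y"
    unfolding canonical_solution_iff by blast
  moreover have "square_integrable H Y"
  proof -
    define K where "K = cA + cB * exp (Im z * \<Lambda>)"
    have cAB: "cA \<ge> 0" "cB \<ge> 0"
      using bA[of 0] bB[of 0] norm_ge_zero order_trans by blast+
    have ne: "norm (e s) = exp (- Im z / 2 * s)" for s
      by (simp add: e_def norm_exp_eq_Re)
    have nf: "norm (f s) = exp (Im z / 2 * s)" for s
      by (simp add: f_def norm_exp_eq_Re)
    \<comment> \<open>Below \<open>\<Lambda>\<close> the quotient of the moduli of \<open>f\<close>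
      and \<open>e\<close> is \<open>exp (Im z * s)\<close>, at most
      \<open>exp (Im z * \<Lambda>)\<close>; from \<open>\<Lambda>\<close> on the left side is
      zero.\<close>
    have fB: "norm (f s * B s) \<le> cB * exp (Im z * \<Lambda>) * norm (e s)" for s
    proof (cases "s \<ge> \<Lambda>")
      case False
      then have "Im z / 2 * s \<le> Im z * \<Lambda> + - Im z / 2 * s"
        using z by (simp add: field_simps)
      then have "norm (f s) \<le> exp (Im z * \<Lambda>) * norm (e s)"
        unfolding ne nf exp_add[symmetric] by simp
      then have "norm (f s) * norm (B s) \<le> exp (Im z * \<Lambda>) * norm (e s) * cB"
        by (intro mult_mono bB) auto
      then show ?thesis by (simp add: norm_mult ac_simps)
    qed (use tail cAB in auto)
    have eA: "norm (e s * A s) \<le> cA * norm (e s)" for s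
      using mult_left_mono[OF bA[of s], of "norm (e s)"] by (simp add: norm_mult ac_simps)
    have ab: "norm (e s * A s) + norm (f s * B s) \<le> K * norm (e s)" for s
      using eA[of s] fB[of s] by (simp add: K_def distrib_right)
    have Yb: "norm (Y s $ 1) + norm (Y s $ 2) \<le> 2 * K * norm (e s)" for s
    proof -
      have "norm (Y s $ 1) \<le> norm (e s * A s) + norm (f s * B s)"
        unfolding Y1 by (rule norm_triangle_ineq)
      moreover have "norm (Y s $ 2) \<le> norm (e s * A s) + norm (f s * B s)"
        unfolding Y2 by (rule order_trans[OF norm_triangle_ineq4]) (simp add: norm_mult)
      ultimately show ?thesis using ab[of s] by simp
    qed
    have cont: "continuous_on {0..} (\<lambda>s. Y s $ i)" for i
      by (intro continuous_intros primitive_of_continuous[OF Y])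
    have Ym: "(\<lambda>s. Y s $ i) \<in> borel_measurable (lebesgue_on {0..})"
      and Ycm: "(\<lambda>s. cnj (Y s $ i)) \<in> borel_measurable (lebesgue_on {0..})" for i
      by (intro borel_measurable_continuous_atLeast(2) continuous_intros cont)+
    have pm: "(\<lambda>s. g (p s)) \<in> borel_measurable (lebesgue_on {0..})"
      if "continuous_on UNIV g" for g :: "complex \<Rightarrow> complex"
      using that p(1) by (rule borel_measurable_continuous_on)
    have "integrable (lebesgue_on {0..}) (\<lambda>s. herm_form (half_id + Xmat (p s)) (Y s))"
    proof (rule Bochner_Integration.integrable_bound)
      show "integrable (lebesgue_on {0..}) (\<lambda>s. (1/2 + M) * (4 * K\<^sup>2) * exp (- Im z * s))"
        using integrable_exp_minus[OF z] by simp
      show "(\<lambda>s. herm_form (half_id + Xmat (p s)) (Y s)) \<in> borel_measurable (lebesgue_on {0..})"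
        unfolding herm_form_eq half_id_plus_Xmat_nth
        by (intro borel_measurable_add borel_measurable_times Ym Ycm pm continuous_intros)
      show "AE s in lebesgue_on {0..}. norm (herm_form (half_id + Xmat (p s)) (Y s)) \<le>
              norm ((1/2 + M) * (4 * K\<^sup>2) * exp (- Im z * s))"
        using p(2)
      proof eventually_elim
        case (elim s)
        have "(norm (Y s $ 1) + norm (Y s $ 2))\<^sup>2 \<le> (2 * K * norm (e s))\<^sup>2"
          by (rule power_mono[OF Yb]) simp
        also have "\<dots> = 4 * K\<^sup>2 * exp (- Im z * s)"
          by (simp add: ne power_mult_distrib exp_double[symmetric] mult.commute)
        finally have "(1/2 + norm (p s)) * (norm (Y s $ 1) + norm (Y s $ 2))\<^sup>2 \<le>
            (1/2 + M) * (4 * K\<^sup>2 * exp (- Im z * s))"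
          using elim order_trans[OF norm_ge_zero elim] by (intro mult_mono) auto
        with norm_herm_form_le[of "p s" "Y s"] show ?case by simp
      qed
    qed
    then show ?thesis
      unfolding square_integrable_def
      by (rule Bochner_Integration.integrable_cong[THEN iffD1, rotated 2]) (auto simp: H)
  qed
  moreover have "Y 0 = vector [A 0 + B 0, \<i> * (A 0 - B 0)]"
    by (simp add: vec_eq_iff forall_2 Y1 Y2 e_def f_def algebra_simps)
  ultimately show ?thesis by blast
qed

section \<open>First-order expansion of the Schur transform\<close>

theorem theorem1p1:
  fixes \<Lambda> :: real and z :: complex
  assumes "\<Lambda> > 0" and "Im z > 0"
  shows "\<exists>r::real. r > 0 \<and> (\<exists>C::real. C > 0 \<and>
    (\<forall>q :: real \<Rightarrow> complex.
       in_L1_Linf \<Lambda> q \<and>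
       Linf_op \<Lambda> (\<lambda>s. Xmat (q s)) \<le> 1/4 \<and>
       L1_op \<Lambda> (\<lambda>s. Xmat (q s)) \<le> r \<longrightarrow>
       (\<exists>R::complex.
          schur_transform (\<lambda>s. half_id + Xmat (q s)) \<Lambda> z =
            - \<i> * z * (LINT s|lebesgue_on {0..\<Lambda>}. q s * exp (\<i> * z * of_real s)) + R \<and>
          norm R \<le> C * (L1_op \<Lambda> (\<lambda>s. Xmat (q s)))\<^sup>2)))"
proof -
  \<comment> \<open>\<open>K\<close> bounds the weight of both kernels relative to \<open>q\<close>:
    \<open>norm z\<close> comes from the factor \<open>\<i> * z\<close>, the exponential from
    \<open>exp_kernel\<close>.\<close>
  define K where "K = norm z * exp (Im z * \<Lambda>)"
  have "z \<noteq> 0" using assms(2) by auto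
  then have "K > 0" by (simp add: K_def)
  show ?thesis
  \<comment> \<open>The radius makes both kernel norms at most 1/4. The Volterra system is then
    contractive and \<open>B 0\<close> has modulus at most 1/2.\<close>
  proof (rule exI[of _ "1 / (4 * K)"], intro exI[of _ "K\<^sup>2"] conjI allI impI)
    fix q :: "real \<Rightarrow> complex"
    assume q: "in_L1_Linf \<Lambda> q \<and> Linf_op \<Lambda> (\<lambda>s. Xmat (q s)) \<le> 1/4 \<and>
       L1_op \<Lambda> (\<lambda>s. Xmat (q s)) \<le> 1 / (4 * K)"
    let ?H = "\<lambda>s. half_id + Xmat (q s)"
    let ?F = "free_tail \<Lambda> ?H"
    define N where "N = L1_op \<Lambda> (\<lambda>s. Xmat (q s))"
    have NK: "K * N \<le> 1/4"
      using q \<open>K > 0\<close> by (simp add: N_def field_simps)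
    \<comment> \<open>The cutoff is half-open to match \<open>s < \<Lambda>\<close> in
      \<open>free_tail\<close>, so the two Hamiltonians agree at every \<open>s \<ge> 0\<close>,
      including \<open>\<Lambda>\<close>.\<close>
    define p where "p s = indicat_real {0..<\<Lambda>} s *\<^sub>R q s" for s
    have qi: "integrable (lebesgue_on {0..\<Lambda>}) q"
      using q by (simp add: in_L1_Linf_def)
    have "integrable (lebesgue_on {0..<\<Lambda>}) q"
      by (rule integrable_lebesgue_on_subset[OF qi]) auto
    then have pi: "integrable lebesgue p"
      unfolding p_def[abs_def] by (rule integrable_restrict_space[THEN iffD1, rotated]) simp
    have np: "(LINT s|lebesgue. norm (p s)) = N"
    proof -
      have "N = (LINT s|lebesgue. indicat_real {0..\<Lambda>} s *\<^sub>R norm (q s))"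
        by (simp add: N_def L1_op_def op_norm_Xmat integral_restrict_space)
      also have "\<dots> = (LINT s|lebesgue. norm (p s))"
      proof (rule integral_cong_AE)
        have "integrable lebesgue (\<lambda>s. indicat_real {0..\<Lambda>} s *\<^sub>R norm (q s))"
          using integrable_norm[OF qi] by (rule integrable_restrict_space[THEN iffD1, rotated]) simp
        then show "(\<lambda>s. indicat_real {0..\<Lambda>} s *\<^sub>R norm (q s)) \<in> borel_measurable lebesgue"
          by (rule borel_measurable_integrable)
        show "(\<lambda>s. norm (p s)) \<in> borel_measurable lebesgue"
          using pi by simp
        have "AE s in lebesgue. s \<noteq> \<Lambda>"
          by (intro AE_completion AE_lborel_singleton)
        then show "AE s in lebesgue. indicat_real {0..\<Lambda>} s *\<^sub>R norm (q s) = norm (p s)"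
          by eventually_elim (auto simp: p_def indicator_def)
      qed
      finally show ?thesis by simp
    qed
    have F: "?F s = half_id + Xmat (p s)" if "s \<ge> 0" for s
      using that by (auto simp: free_tail_def p_def indicator_def vec_eq_iff forall_2)
    \<comment> \<open>The L-infinity smallness enters here: it supplies the almost everywhere bound
      used for square integrability of the solution.\<close>
    have pb: "AE s in lebesgue_on {0..}. norm (p s) \<le> 1/4"
    proof -
      have "(\<lambda>s. op_norm (Xmat (q s))) \<in> borel_measurable (lebesgue_on {0..\<Lambda>})"
        using qi by (simp add: op_norm_Xmat)
      then have "AE s in lebesgue_on {0..\<Lambda>}. ereal (op_norm (Xmat (q s))) \<le> 1/4"
        using esssup_AE[of "\<lambda>s. ereal (op_norm (Xmat (q s)))" "lebesgue_on {0..\<Lambda>}"] q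
        unfolding Linf_op_def by (auto elim: eventually_mono)
      then have "AE s in lebesgue. s \<in> {0..\<Lambda>} \<longrightarrow> norm (q s) \<le> 1/4"
        by (simp add: AE_restrict_space_iff op_norm_Xmat one_ereal_def numeral_eq_ereal)
      then have "AE s in lebesgue. s \<in> {0..} \<longrightarrow> norm (p s) \<le> 1/4"
        by eventually_elim (auto simp: p_def indicator_def)
      then show ?thesis by (simp add: AE_restrict_space_iff)
    qed
    define e where "e s = exp (\<i> * z * of_real s)" for s :: real
    define f where "f s = exp (- (\<i> * z * of_real s))" for s :: real
    define k1 where "k1 s = \<i> * z * cnj (p s) * f s" for s
    define k2 where "k2 s = \<i> * z * p s * e s" for s
    have p0: "s \<notin> {0..\<Lambda>} \<Longrightarrow> p s = 0" for s
      by (auto simp: p_def)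
    have k1: "k1 = (\<lambda>s. \<i> * z * cnj (p s) * exp (- (\<i> * z) * of_real s))"
      and k2: "k2 = (\<lambda>s. \<i> * z * p s * exp (\<i> * z * of_real s))"
      by (simp_all add: fun_eq_iff k1_def k2_def e_def f_def)
    have k1i: "integrable lebesgue k1" and k2i: "integrable lebesgue k2"
      unfolding k1 k2
      by (rule exp_kernel[where \<Lambda>=\<Lambda> and y="Im z"]; use pi p0 assms(2) in simp)+
    define N1 where "N1 = (LINT u|lebesgue. norm (k1 u))"
    define N2 where "N2 = (LINT u|lebesgue. norm (k2 u))"
    have "N1 \<le> exp (Im z * \<Lambda>) * (LINT s|lebesgue. norm (\<i> * z * cnj (p s)))"
      unfolding N1_def k1 by (rule exp_kernel(2); use pi p0 assms(2) in simp)
    then have N1: "N1 \<le> K * N"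
      by (simp add: norm_mult np K_def ac_simps)
    have "N2 \<le> exp (Im z * \<Lambda>) * (LINT s|lebesgue. norm (\<i> * z * p s))"
      unfolding N2_def k2 by (rule exp_kernel(2); use pi p0 assms(2) in simp)
    then have N2: "N2 \<le> K * N"
      by (simp add: norm_mult np K_def ac_simps)
    have N12: "N1 \<ge> 0" "N2 \<ge> 0" by (simp_all add: N1_def N2_def)
    have "N1 * N2 \<le> 1/4 * (1/4)"
      using N1 N2 NK N12 by (intro mult_mono) auto
    then have "(LINT u|lebesgue. norm (k1 u)) * (LINT u|lebesgue. norm (k2 u)) \<le> 1/2"
      by (simp add: N1_def N2_def)
    then obtain A B where Ac: "continuous_on UNIV A" and Bc: "continuous_on UNIV B"
      and A: "\<And>s. A s = 1 + (LINT u|lebesgue. indicator {0..s} u *\<^sub>R (k1 u * B u))"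
      and B: "\<And>s. B s = (LINT u|lebesgue. indicator {s<..} u *\<^sub>R (k2 u * A u))"
      and bA: "\<And>s. norm (A s) \<le> 2" and bB': "\<And>s. norm (B s) \<le> (LINT u|lebesgue. norm (k2 u)) * 2"
      by (rule volterra_pair_exists[OF k1i k2i _ that])
    note bB = bB'[folded N2_def]
    have mA: "A \<in> borel_measurable lebesgue" and mB: "B \<in> borel_measurable lebesgue"
      using Ac Bc by (auto intro: borel_measurable_lebesgue_continuous)
    have iB: "integrable lebesgue (\<lambda>u. k1 u * B u)"
      by (rule integrable_mult_bounded[OF k1i mB bB])
    have iA: "integrable lebesgue (\<lambda>u. k2 u * A u)"
      by (rule integrable_mult_bounded[OF k2i mA bA])
    have primA: "primitive_of (\<lambda>u. k1 u * B u) A"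
      by (rule primitive_ofI[where c=1]) (auto intro: integrable_lebesgue_onI[OF iB] simp: integral_lebesgue_on_indicator A[symmetric])
    have k0: "k2 s = 0" if "s < 0 \<or> s \<ge> \<Lambda>" for s
      using that by (auto simp: k2_def p_def)
    have primB: "primitive_of (\<lambda>u. - (k2 u * A u)) B"
    proof (rule primitive_ofI)
      fix t :: real assume t: "t \<ge> 0"
      show "integrable (lebesgue_on {0..t}) (\<lambda>u. - (k2 u * A u))"
        by (intro integrable_lebesgue_onI integrable_minus iA) simp
      \<comment> \<open>Since \<open>k2\<close> vanishes for negative arguments, the integral beyond
        \<open>t\<close> is the total integral minus the one over \<open>{0..t}\<close>. The total
        is thus the constant in \<open>primitive_ofI\<close>.\<close>
      have "(LINT u|lebesgue. k2 u * A u) = (LINT u|lebesgue. indicator {0..t} u *\<^sub>R (k2 u * A u)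
          + indicator {t<..} u *\<^sub>R (k2 u * A u))"
        by (rule Bochner_Integration.integral_cong) (use k0 t in \<open>auto simp: indicator_def\<close>)
      also have "\<dots> = (LINT u|lebesgue_on {0..t}. k2 u * A u) + B t"
        by (simp add: integral_lebesgue_on_indicator B[symmetric] integrable_mult_indicator iA del: scaleR_conv_of_real)
      finally show "B t = (LINT u|lebesgue. k2 u * A u) + (LINT u|lebesgue_on {0..t}. - (k2 u * A u))"
        by simp
    qed
    have B0: "B s = 0" if "s \<ge> \<Lambda>" for s
    proof -
      have "(\<lambda>u. indicator {s<..} u *\<^sub>R (k2 u * A u)) = (\<lambda>u. 0)"
        using that k0 by (auto simp: indicator_def fun_eq_iff)
      then show ?thesis unfolding B[of s] by simp
    qed
    have A0: "A 0 = 1"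
    proof -
      have "AE u in lebesgue. u \<noteq> (0::real)"
        by (intro AE_completion AE_lborel_singleton)
      then have "AE u in lebesgue. indicat_real {0..0} u *\<^sub>R (k1 u * B u) = 0"
        by eventually_elim (auto simp: indicator_def)
      then show ?thesis unfolding A[of 0] by (simp add: integral_eq_zero_AE)
    qed
    define \<beta> where "\<beta> = B 0"
    have b12: "norm \<beta> \<le> 1/2" using bB[of 0] N2 NK unfolding \<beta>_def by linarith
    have b1: "1 + \<beta> \<noteq> 0"
    proof
      assume "1 + \<beta> = 0"
      then have "\<beta> = - 1" by (simp add: add_eq_0_iff)
      then show False using b12 by simp
    qed
    \<comment> \<open>As \<open>A 0 = 1\<close>, scaling the pair by \<open>c\<close> makes the
      first component of the initial vector 1; \<open>m\<close> is then its second
      component.\<close>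
    define c where "c = 1 / (1 + \<beta>)"
    define m where "m = \<i> * (1 - \<beta>) / (1 + \<beta>)"
    have "\<exists>Y. canonical_solution ?F z Y \<and> square_integrable ?F Y \<and>
       Y 0 = vector [c * A 0 + c * B 0, \<i> * (c * A 0 - c * B 0)]"
    proof (rule decaying_solution_exists[OF assms(2), where p=p and cA="norm c * 2" and cB="norm c * (N2 * 2)" and M="1/4" and \<Lambda>=\<Lambda>])
      have "(\<lambda>s. c * (k1 s * B s)) = (\<lambda>s. \<i> * z * cnj (p s) * exp (- (\<i> * z * of_real s)) * (c * B s))"
        by (simp add: k1_def f_def fun_eq_iff)
      then show "primitive_of (\<lambda>s. \<i> * z * cnj (p s) * exp (- (\<i> * z * of_real s)) * (c * B s)) (\<lambda>s. c * A s)"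
        using primitive_of_bounded_linear[OF bounded_linear_mult_right[of c] primA] by simp
      have "(\<lambda>s. c * - (k2 s * A s)) = (\<lambda>s. - (\<i> * z * p s * exp (\<i> * z * of_real s) * (c * A s)))"
        by (simp add: k2_def e_def fun_eq_iff)
      then show "primitive_of (\<lambda>s. - (\<i> * z * p s * exp (\<i> * z * of_real s) * (c * A s))) (\<lambda>s. c * B s)"
        using primitive_of_bounded_linear[OF bounded_linear_mult_right[of c] primB] by simp
      show "norm (c * A s) \<le> norm c * 2" "norm (c * B s) \<le> norm c * (N2 * 2)" for s
        unfolding norm_mult by (intro mult_left_mono bA bB norm_ge_zero)+
      show "p \<in> borel_measurable (lebesgue_on {0..})"
        by (rule borel_measurable_integrable[OF integrable_lebesgue_onI[OF pi]]) simp
    qed (use B0 pb F in auto)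
    moreover have "vector [c * A 0 + c * B 0, \<i> * (c * A 0 - c * B 0)] = (vector [1, m] :: complex^2)"
      using b1 by (simp add: vec_eq_iff forall_2 A0 c_def m_def \<beta>_def[symmetric] add_divide_distrib[symmetric]
          diff_divide_distrib[symmetric])
    ultimately obtain Y where Y: "canonical_solution ?F z Y" "square_integrable ?F Y" "Y 0 = vector [1, m]"
      by auto
    have "weyl_coeff ?H \<Lambda> z = m"
      by (rule weyl_coeff_eqI[OF _ _ Y(1,3,2)]) (use assms(1) in auto)
    \<comment> \<open>The Schur transform inverts the Cayley-type formula for \<open>m\<close>, so
      that only the ratio - B(0) / A(0) = - \<beta> survives.\<close>
    have cancel: "(- 2 * \<i> * \<beta> / d) / (2 * \<i> / d) = - \<beta>" if "d \<noteq> 0" for d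
      using that by (simp add: field_simps)
    from \<open>weyl_coeff ?H \<Lambda> z = m\<close>
    have "schur_transform ?H \<Lambda> z = (m - \<i>) / (m + \<i>)"
      by (simp add: schur_transform_def)
    also have "m - \<i> = - 2 * \<i> * \<beta> / (1 + \<beta>)"
      unfolding m_def using b1 by (simp add: field_simps)
    also have "m + \<i> = 2 * \<i> / (1 + \<beta>)"
      unfolding m_def using b1 by (simp add: field_simps)
    also have "(- 2 * \<i> * \<beta> / (1 + \<beta>)) / (2 * \<i> / (1 + \<beta>)) = - \<beta>"
      by (rule cancel[OF b1])
    finally have v: "schur_transform ?H \<Lambda> z = - \<beta>" .
    \<comment> \<open>The remainder collects what is lost on replacing \<open>A\<close> by 1 under
      the integral for \<open>\<beta>\<close>. The sign is that of \<open>- \<beta>\<close>.\<close>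
    define R where "R = - (LINT u|lebesgue. indicator {0<..} u *\<^sub>R (k2 u * (A u - 1)))"
    have bA1: "norm (A s - 1) \<le> N1 * (N2 * 2)" for s
      unfolding A[of s] N1_def add_diff_cancel_left'
      by (rule norm_kernel_integral_le[OF k1i mB _ bB]) simp
    have mA1: "(\<lambda>s. A s - 1) \<in> borel_measurable lebesgue" using mA by simp
    have "norm R \<le> N2 * (N1 * (N2 * 2))"
      unfolding R_def norm_minus_cancel N2_def[symmetric]
      using norm_kernel_integral_le[OF k2i mA1 _ bA1, of "{0<..}"] by (simp add: N2_def)
    \<comment> \<open>The bound is cubic in the kernel norms; one factor, \<open>N1\<close>, is
      spent on the smallness bound 1/4, which leaves a quadratic estimate.\<close>
    also have "\<dots> \<le> (K * N) * (1/4 * (K * N * 2))"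
      using N1 N2 NK N12 by (intro mult_mono) auto
    also have "\<dots> = K\<^sup>2 * N\<^sup>2 / 2" by (simp add: power2_eq_square)
    also have "\<dots> \<le> K\<^sup>2 * N\<^sup>2" by simp
    finally have Rb: "norm R \<le> K\<^sup>2 * N\<^sup>2" .
    have "\<beta> = (LINT u|lebesgue. indicator {0<..} u *\<^sub>R k2 u + indicator {0<..} u *\<^sub>R (k2 u * (A u - 1)))"
      unfolding \<beta>_def B[of 0] by (simp add: algebra_simps)
    also have "\<dots> = (LINT u|lebesgue. indicator {0<..} u *\<^sub>R k2 u) - R"
      unfolding R_def
      by (subst Bochner_Integration.integral_add)
        (auto intro!: integrable_mult_indicator k2i integrable_mult_bounded[OF k2i mA1 bA1])
    \<comment> \<open>The open half-line and the cutoff in \<open>p\<close> change the integrand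
      only at the null points 0 and \<open>\<Lambda>\<close>.\<close>
    also have "(LINT u|lebesgue. indicator {0<..} u *\<^sub>R k2 u) =
        (LINT u|lebesgue. indicator {0..\<Lambda>} u *\<^sub>R (\<i> * z * (q u * e u)))"
    proof (rule integral_cong_AE)
      show "(\<lambda>u. indicator {0<..} u *\<^sub>R k2 u) \<in> borel_measurable lebesgue"
        by (intro borel_measurable_integrable integrable_mult_indicator k2i) simp
      have "integrable (lebesgue_on {0..\<Lambda>}) (\<lambda>u. \<i> * z * (q u * e u))"
        unfolding e_def
        by (intro integrable_mult_right integrable_mult_continuous[OF qi] continuous_intros)
      then have "integrable lebesgue (\<lambda>u. indicator {0..\<Lambda>} u *\<^sub>R (\<i> * z * (q u * e u)))"
        by (rule integrable_restrict_space[THEN iffD1, rotated]) simp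
      then show "(\<lambda>u. indicator {0..\<Lambda>} u *\<^sub>R (\<i> * z * (q u * e u))) \<in> borel_measurable lebesgue"
        by (rule borel_measurable_integrable)
      have "AE u in lebesgue. u \<noteq> \<Lambda>" "AE u in lebesgue. u \<noteq> 0"
        by (intro AE_completion AE_lborel_singleton)+
      then show "AE u in lebesgue. indicator {0<..} u *\<^sub>R k2 u = indicator {0..\<Lambda>} u *\<^sub>R (\<i> * z * (q u * e u))"
        by eventually_elim (auto simp: k2_def p_def indicator_def)
    qed
    also have "\<dots> = \<i> * z * (LINT u|lebesgue_on {0..\<Lambda>}. q u * e u)"
      by (subst integral_lebesgue_on_indicator[symmetric]) auto
    finally have "- \<beta> = - \<i> * z * (LINT u|lebesgue_on {0..\<Lambda>}. q u * e u) + R"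
      by simp
    with v Rb show "\<exists>R. schur_transform ?H \<Lambda> z =
            - \<i> * z * (LINT s|lebesgue_on {0..\<Lambda>}. q s * exp (\<i> * z * of_real s)) + R \<and>
          norm R \<le> K\<^sup>2 * (L1_op \<Lambda> (\<lambda>s. Xmat (q s)))\<^sup>2"
      unfolding e_def N_def by auto
  qed (use \<open>K > 0\<close> in auto)
qed

end
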